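(* Let $\mathbf{e}_1,\mathbf{e}_2,\mathbf{e}_3$ be a left invariant frame on the three-dimensional Heisenberg group whose only non-zero bracket is $[\mathbf{e}_2,\mathbf{e}_3]=\mathbf{e}_1$, with dual coframe $\omega^1,\omega^2,\omega^3$, and let $A>0$. The left invariant metric $\mathbf{g}_0=A\,\omega^{1}\otimes\omega^{1}+\omega^{2}\otimes\omega^{2}+\omega^{3}\otimes\omega^{3}$ is a steady algebraic soliton that gives rise to a self-similar solution of the $\mathrm{RG}$-$2$ flow $$\frac{\partial\mathbf{g}}{\partial t}=-2\,\mathbf{Rc}[\mathbf{g}]-\frac{4}{3A}\,\mathbf{Rm}^{2}[\mathbf{g}]$$ (i.e. of the $\mathrm{RG}$-$2$ flow with coupling constant $\alpha=\frac{8}{3A}$).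
   Context: The Heisenberg group is the simply connected Lie group with the given three-dimensional Lie algebra $\mathfrak{h}$. $\mathbf{Rc}[\mathbf{g}]$ is the Ricci tensor, and $\mathbf{Rm}^{2}[\mathbf{g}]$ is the symmetric $(0,2)$-tensor with components $\check{R}_{ij}=Rm_{iklm}Rm_{jpqr}g^{kp}g^{lq}g^{mr}$, where $Rm_{ijkl}$ is the Riemannian curvature tensor of $\mathbf{g}$. The $\mathrm{RG}$-$2$ flow with coupling constant $\alpha$ is $\frac{\partial\mathbf{g}}{\partial t}=\mathbf{RG}[\mathbf{g}]$, where $\mathbf{RG}[\mathbf{g}]=-2\mathbf{Rc}[\mathbf{g}]-\frac{\alpha}{2}\mathbf{Rm}^{2}[\mathbf{g}]$. In the flow displayed in the claim, $A$ is the fixed constant appearing in $\mathbf{g}_0$. The operator $\widehat{\mathbf{RG}[\mathbf{g}]}:\mathfrak{h}\to\mathfrak{h}$ is defined by $\mathbf{g}(\widehat{\mathbf{RG}[\mathbf{g}]}(X),Y)=\mathbf{RG}[\mathbf{g}](X,Y)$. A left invariant metric $\mathbf{g}$ is a steady algebraic soliton for the flow if $\widehat{\mathbf{RG}[\mathbf{g}]}$ is a derivation of $\mathfrak{h}$ (i.e. $\widehat{\mathbf{RG}[\mathbf{g}]}-\kappa\,\mathrm{Id}$ is a derivation with $\kappa=0$). A self-similar solution is a solution of the form $\mathbf{g}(t)=c(t)\varphi_t^{*}\mathbf{g}_0$, with $\varphi_t$ a one-parameter family of diffeomorphisms, $\varphi_0=\mathrm{Id}$, and $c$ a real-valued function with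 $c(0)=1$. *)

theory Defs
  imports "HOL-Analysis.Analysis"
begin

primrec C_k :: "nat \<Rightarrow> ('a::euclidean_space \<Rightarrow> 'b::euclidean_space) \<Rightarrow> bool" where
  "C_k 0 f \<longleftrightarrow> continuous_on UNIV f"
| "C_k (Suc k) f \<longleftrightarrow>
     (\<forall>x. f differentiable (at x)) \<and> (\<forall>v. C_k k (\<lambda>x. frechet_derivative f (at x) v))"

definition smooth :: "('a::euclidean_space \<Rightarrow> 'b::euclidean_space) \<Rightarrow> bool" where
  "smooth f \<longleftrightarrow> (\<forall>k. C_k k f)"

definition diffeomorphism :: "('a::euclidean_space \<Rightarrow> 'a) \<Rightarrow> bool" where
  "diffeomorphism f \<longleftrightarrow> bij f \<and> smooth f \<and> smooth (inv f)"

definition one_parameter_family :: "(real \<Rightarrow> 'a::euclidean_space \<Rightarrow> 'a) \<Rightarrow> bool" where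
  "one_parameter_family \<phi> \<longleftrightarrow>
     (\<forall>t. diffeomorphism (\<phi> t)) \<and> smooth (\<lambda>(t, x). \<phi> t x)"

type_synonym 'n vector_field = "real^'n \<Rightarrow> real^'n"
type_synonym 'n one_form = "real^'n \<Rightarrow> real^'n \<Rightarrow> real"
type_synonym 'n tensor2 = "real^'n \<Rightarrow> real^'n \<Rightarrow> real^'n \<Rightarrow> real"

definition lie_bracket :: "'n::finite vector_field \<Rightarrow> 'n vector_field \<Rightarrow> 'n vector_field" where
  "lie_bracket X Y =
     (\<lambda>p. frechet_derivative Y (at p) (X p) - frechet_derivative X (at p) (Y p))"

definition tensor_prod :: "'n::finite one_form \<Rightarrow> 'n one_form \<Rightarrow> 'n tensor2"
    (infixl "\<otimes>\<^sub>f" 72) where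
  "(\<alpha> \<otimes>\<^sub>f \<beta>) = (\<lambda>p u v. \<alpha> p u * \<beta> p v)"

definition pullback :: "(real^'n \<Rightarrow> real^'n) \<Rightarrow> 'n::finite tensor2 \<Rightarrow> 'n tensor2" where
  "pullback \<phi> T =
     (\<lambda>p u v. T (\<phi> p) (frechet_derivative \<phi> (at p) u) (frechet_derivative \<phi> (at p) v))"

definition riemannian_metric :: "'n::finite tensor2 \<Rightarrow> bool" where
  "riemannian_metric g \<longleftrightarrow>
     (\<forall>p. bilinear (g p)) \<and>
     (\<forall>p u v. g p u v = g p v u) \<and>
     (\<forall>p u. u \<noteq> 0 \<longrightarrow> g p u u > 0) \<and>
     (\<forall>u v. smooth (\<lambda>p. g p u v))"

definition partial :: "'n \<Rightarrow> (real^'n \<Rightarrow> real) \<Rightarrow> real^'n::finite \<Rightarrow> real" where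
  "partial i f p = frechet_derivative f (at p) (axis i 1)"

definition lower :: "'n::finite tensor2 \<Rightarrow> real^'n \<Rightarrow> real^'n^'n" where
  "lower g p = (\<chi> i j. g p (axis i 1) (axis j 1))"

definition upper :: "'n::finite tensor2 \<Rightarrow> real^'n \<Rightarrow> real^'n^'n" where
  "upper g p = matrix_inv (lower g p)"

text \<open>\<open>christoffel g k i j p\<close> is $\Gamma^k_{ij}(p)$.\<close>

definition christoffel :: "'n::finite tensor2 \<Rightarrow> 'n \<Rightarrow> 'n \<Rightarrow> 'n \<Rightarrow> real^'n \<Rightarrow> real" where
  "christoffel g k i j p =
     (1/2) * (\<Sum>l\<in>UNIV. upper g p $ k $ l *
        (partial i (\<lambda>q. lower g q $ j $ l) p
         + partial j (\<lambda>q. lower g q $ i $ l) p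
         - partial l (\<lambda>q. lower g q $ i $ j) p))"

text \<open>\<open>riemann_up g i j k l p\<close> is $R_{ijk}{}^{l}(p)$, where
  $R(\partial_i,\partial_j)\partial_k = R_{ijk}{}^{l}\partial_l$ and
  $R(X,Y)Z = \nabla_X\nabla_Y Z - \nabla_Y\nabla_X Z - \nabla_{[X,Y]}Z$;
  the Ricci tensor is $R_{jk} = R_{ijk}{}^{i}$, which is positive on round spheres.\<close>

definition riemann_up ::
    "'n::finite tensor2 \<Rightarrow> 'n \<Rightarrow> 'n \<Rightarrow> 'n \<Rightarrow> 'n \<Rightarrow> real^'n \<Rightarrow> real" where
  "riemann_up g i j k l p =
     partial i (christoffel g l j k) p - partial j (christoffel g l i k) p
     + (\<Sum>m\<in>UNIV. christoffel g m j k p * christoffel g l i m p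
                  - christoffel g m i k p * christoffel g l j m p)"

definition Rm ::
    "'n::finite tensor2 \<Rightarrow> 'n \<Rightarrow> 'n \<Rightarrow> 'n \<Rightarrow> 'n \<Rightarrow> real^'n \<Rightarrow> real" where
  "Rm g i j k l p = (\<Sum>m\<in>UNIV. riemann_up g i j k m p * lower g p $ m $ l)"

definition of_components :: "('n \<Rightarrow> 'n \<Rightarrow> real^'n \<Rightarrow> real) \<Rightarrow> 'n::finite tensor2" where
  "of_components c = (\<lambda>p u v. \<Sum>i\<in>UNIV. \<Sum>j\<in>UNIV. c i j p * u $ i * v $ j)"

definition Rc :: "'n::finite tensor2 \<Rightarrow> 'n tensor2" where
  "Rc g = of_components (\<lambda>j k p. \<Sum>i\<in>UNIV. riemann_up g i j k i p)"

definition Rm_squared :: "'n::finite tensor2 \<Rightarrow> 'n tensor2" where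
  "Rm_squared g = of_components (\<lambda>i j p.
     \<Sum>k\<in>UNIV. \<Sum>l\<in>UNIV. \<Sum>m\<in>UNIV. \<Sum>a\<in>UNIV. \<Sum>b\<in>UNIV. \<Sum>c\<in>UNIV.
       Rm g i k l m p * Rm g j a b c p *
       upper g p $ k $ a * upper g p $ l $ b * upper g p $ m $ c)"

definition RG :: "real \<Rightarrow> 'n::finite tensor2 \<Rightarrow> 'n tensor2" where
  "RG \<alpha> g = (\<lambda>p u v. - 2 * Rc g p u v - \<alpha> / 2 * Rm_squared g p u v)"

definition flow_solution ::
    "('n::finite tensor2 \<Rightarrow> 'n tensor2) \<Rightarrow> (real \<Rightarrow> 'n tensor2) \<Rightarrow> bool" where
  "flow_solution F g \<longleftrightarrow>
     (\<forall>t. riemannian_metric (g t)) \<and>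
     (\<forall>t p u v. ((\<lambda>s. g s p u v) has_real_derivative F (g t) p u v) (at t))"

definition self_similar_solution ::
    "('n::finite tensor2 \<Rightarrow> 'n tensor2) \<Rightarrow> 'n tensor2 \<Rightarrow> (real \<Rightarrow> 'n tensor2) \<Rightarrow> bool" where
  "self_similar_solution F g0 g \<longleftrightarrow>
     flow_solution F g \<and>
     (\<exists>c \<phi>. c 0 = 1 \<and> one_parameter_family \<phi> \<and> \<phi> 0 = id \<and>
        (\<forall>t. g t = (\<lambda>p u v. c t * pullback (\<phi> t) g0 p u v)))"

text \<open>Exponential coordinates on the simply connected Heisenberg group: the product is
  \<open>x + y + [x, y] / 2\<close> (Baker-Campbell-Hausdorff), where the bracket of \<open>real^3\<close> is the one
  for which the standard basis satisfies \<open>[b\<^sub>2, b\<^sub>3] = b\<^sub>1\<close> and \<open>b\<^sub>1\<close> is central.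
  The underlying manifold is \<open>real^3\<close>, and its identity map is a global chart.\<close>

definition heis_mult :: "real^3 \<Rightarrow> real^3 \<Rightarrow> real^3" (infixl "\<bullet>\<^sub>H" 70) where
  "x \<bullet>\<^sub>H y = vector [x$1 + y$1 + (x$2 * y$3 - x$3 * y$2) / 2, x$2 + y$2, x$3 + y$3]"

lemma heis_mult_assoc: "(x \<bullet>\<^sub>H y) \<bullet>\<^sub>H z = x \<bullet>\<^sub>H (y \<bullet>\<^sub>H z)"
  by (simp add: heis_mult_def vec_eq_iff forall_3 vector_3 field_simps)

lemma heis_mult_zero [simp]: "0 \<bullet>\<^sub>H x = x" "x \<bullet>\<^sub>H 0 = x"
  by (simp_all add: heis_mult_def vec_eq_iff forall_3 vector_3)

lemma heis_mult_minus [simp]: "- x \<bullet>\<^sub>H x = 0" "x \<bullet>\<^sub>H - x = 0"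
  by (simp_all add: heis_mult_def vec_eq_iff forall_3 vector_3)

definition left_invariant_field :: "3 vector_field \<Rightarrow> bool" where
  "left_invariant_field X \<longleftrightarrow>
     (\<forall>a p. X (a \<bullet>\<^sub>H p) = frechet_derivative ((\<bullet>\<^sub>H) a) (at p) (X p))"

definition heis_algebra :: "3 vector_field set" where
  "heis_algebra = {X. left_invariant_field X}"

definition left_invariant_metric :: "3 tensor2 \<Rightarrow> bool" where
  "left_invariant_metric g \<longleftrightarrow> riemannian_metric g \<and> (\<forall>a. pullback ((\<bullet>\<^sub>H) a) g = g)"

definition left_invariant_frame :: "(3 \<Rightarrow> 3 vector_field) \<Rightarrow> bool" where
  "left_invariant_frame e \<longleftrightarrow>
     (\<forall>i. e i \<in> heis_algebra) \<and>
     (\<forall>p. inj (\<lambda>i. e i p) \<and> independent (range (\<lambda>i. e i p)) \<and>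
          span (range (\<lambda>i. e i p)) = UNIV)"

definition dual_coframe :: "(3 \<Rightarrow> 3 vector_field) \<Rightarrow> (3 \<Rightarrow> 3 one_form) \<Rightarrow> bool" where
  "dual_coframe e \<omega> \<longleftrightarrow>
     (\<forall>p i. linear (\<omega> i p)) \<and> (\<forall>p i j. \<omega> i p (e j p) = (if i = j then 1 else 0))"

definition derivation :: "(3 vector_field \<Rightarrow> 3 vector_field) \<Rightarrow> bool" where
  "derivation D \<longleftrightarrow>
     (\<forall>X\<in>heis_algebra. D X \<in> heis_algebra) \<and>
     (\<forall>X\<in>heis_algebra. \<forall>Y\<in>heis_algebra. D (\<lambda>p. X p + Y p) = (\<lambda>p. D X p + D Y p)) \<and>
     (\<forall>r. \<forall>X\<in>heis_algebra. D (\<lambda>p. r *\<^sub>R X p) = (\<lambda>p. r *\<^sub>R D X p)) \<and>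
     (\<forall>X\<in>heis_algebra. \<forall>Y\<in>heis_algebra.
        D (lie_bracket X Y) = (\<lambda>p. lie_bracket (D X) Y p + lie_bracket X (D Y) p))"

text \<open>For a left invariant metric \<open>g\<close> and a left invariant \<open>T\<close> the field \<open>Z\<close> exists and is
  unique by nondegeneracy; \<open>algebraic_soliton\<close> only uses \<open>hat\<close> in that situation.\<close>

definition hat :: "3 tensor2 \<Rightarrow> 3 tensor2 \<Rightarrow> 3 vector_field \<Rightarrow> 3 vector_field" where
  "hat g T X = (THE Z. Z \<in> heis_algebra \<and>
     (\<forall>Y\<in>heis_algebra. \<forall>p. g p (Z p) (Y p) = T p (X p) (Y p)))"

definition algebraic_soliton :: "real \<Rightarrow> real \<Rightarrow> 3 tensor2 \<Rightarrow> bool" where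
  "algebraic_soliton \<alpha> \<kappa> g \<longleftrightarrow>
     left_invariant_metric g \<and> derivation (\<lambda>X p. hat g (RG \<alpha> g) X p - \<kappa> *\<^sub>R X p)"

definition steady_algebraic_soliton :: "real \<Rightarrow> 3 tensor2 \<Rightarrow> bool" where
  "steady_algebraic_soliton \<alpha> g \<longleftrightarrow> algebraic_soliton \<alpha> 0 g"

end

theory Submission
  imports Defs
begin

text \<open>Write \<open>[x, y]\<close> for the \<open>b\<^sub>1\<close>-coefficient of the bracket. In exponential coordinates every
  left invariant frame with the given brackets is the image of the standard frame under a linear
  group automorphism, so \<open>g0\<close> is the pullback of
  \<open>A \<theta> \<otimes> \<theta> + dx\<^sub>2 \<otimes> dx\<^sub>2 + dx\<^sub>3 \<otimes> dx\<^sub>3\<close> with \<open>\<theta>\<^sub>q(u) = u\<^sub>1 - [q, u] / 2\<close>.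
  Left translations and linear automorphisms are affine maps of \<open>real^3\<close>, and curvature is natural
  under affine maps, so it only has to be computed for this metric at the origin. For
  \<open>\<alpha> = 8 / (3 A)\<close> the tensor \<open>RG\<close> has the eigenvalues \<open>-4A/3, -2A/3, -2A/3\<close>; since
  \<open>4A/3 = 2A/3 + 2A/3\<close> this is a derivation. It generates the automorphisms
  \<open>(s\<^sup>2 x\<^sub>1, s x\<^sub>2, s x\<^sub>3)\<close> with \<open>s = exp (-A t / 3)\<close>, and the pullbacks of \<open>g0\<close> under them solve
  the flow with \<open>c = 1\<close>.\<close>

section \<open>Smooth maps\<close>

lemma C_k_const: "C_k k (\<lambda>x. c)"
  by (induction k arbitrary: c) auto

text \<open>The product rule leaves one factor undifferentiated, so the induction in
  \<open>C_k_scaleR\<close> has to lower the order of that factor.\<close>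

lemma C_k_mono_Suc: "C_k (Suc k) f \<Longrightarrow> C_k k f"
proof (induction k arbitrary: f)
  case 0
  then show ?case
    by (auto intro!: continuous_at_imp_continuous_on differentiable_imp_continuous_within)
next
  case (Suc k)
  then show ?case by (metis C_k.simps(2))
qed

lemma smooth_imp_differentiable: "smooth f \<Longrightarrow> f differentiable at x"
  unfolding smooth_def by (metis C_k.simps(2))

lemma C_k_add: "C_k k f \<Longrightarrow> C_k k g \<Longrightarrow> C_k k (\<lambda>x. f x + g x)"
proof (induction k arbitrary: f g)
  case 0
  then show ?case by (auto intro: continuous_on_add)
next
  case (Suc k)
  then have d: "((\<lambda>x. f x + g x) has_derivative
      (\<lambda>v. frechet_derivative f (at x) v + frechet_derivative g (at x) v)) (at x)" for x
    by (intro has_derivative_add) (auto simp: frechet_derivative_works)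
  with Suc show ?case
    by (auto simp: differentiable_def frechet_derivative_at[OF d, symmetric])
qed

lemma frechet_derivative_linear:
  fixes f :: "'a::euclidean_space \<Rightarrow> 'b::euclidean_space"
  assumes "linear f"
  shows "frechet_derivative f (at x) = f"
  by (metis assms frechet_derivative_at linear_imp_has_derivative)

lemma C_k_linear: "linear f \<Longrightarrow> C_k k f"
  by (cases k) (auto simp: frechet_derivative_linear C_k_const linear_imp_differentiable
      linear_continuous_on linear_conv_bounded_linear)

lemma C_k_scaleR:
  fixes f :: "'a::euclidean_space \<Rightarrow> real" and g :: "'a \<Rightarrow> 'b::euclidean_space"
  shows "C_k k f \<Longrightarrow> C_k k g \<Longrightarrow> C_k k (\<lambda>x. f x *\<^sub>R g x)"
proof (induction k arbitrary: f g)
  case 0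
  then show ?case by (auto intro: continuous_on_scaleR)
next
  case (Suc k)
  have df: "(f has_derivative frechet_derivative f (at x)) (at x)"
    and dg: "(g has_derivative frechet_derivative g (at x)) (at x)" for x
    using Suc.prems by (auto simp: frechet_derivative_works)
  have d: "((\<lambda>x. f x *\<^sub>R g x) has_derivative (\<lambda>v. f x *\<^sub>R frechet_derivative g (at x) v
      + frechet_derivative f (at x) v *\<^sub>R g x)) (at x)" for x
    by (rule has_derivative_scaleR[OF df dg])
  have "C_k k (\<lambda>x. f x *\<^sub>R frechet_derivative g (at x) v + frechet_derivative f (at x) v *\<^sub>R g x)" for v
    using Suc.prems by (intro C_k_add Suc.IH) (auto intro: C_k_mono_Suc)
  with d show ?case
    by (auto simp: differentiable_def frechet_derivative_at[OF d, symmetric])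
qed

text \<open>Each directional derivative is the same function times the constant \<open>l v\<close>,
  so the induction closes on itself. It supplies the only non-polynomial ingredient of the soliton
  flow.\<close>

lemma C_k_exp_linear:
  fixes l :: "'a::euclidean_space \<Rightarrow> real"
  assumes "linear l"
  shows "C_k k (\<lambda>x. exp (l x))"
proof (induction k)
  case 0
  have "continuous_on UNIV l"
    using assms by (simp add: linear_continuous_on linear_conv_bounded_linear)
  then show ?case by (auto intro: continuous_on_exp)
next
  case (Suc k)
  have d: "((\<lambda>x. exp (l x)) has_derivative (\<lambda>v. exp (l x) *\<^sub>R l v)) (at x)" for x
    using has_derivative_exp[OF linear_imp_has_derivative[OF assms]] by (simp add: mult.commute)
  have "C_k k (\<lambda>x. exp (l x) *\<^sub>R l v)" for v
    by (intro C_k_scaleR Suc C_k_const)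
  with d show ?case
    by (auto simp: differentiable_def frechet_derivative_at[OF d, symmetric])
qed

lemma has_derivative_affine_compose:
  fixes P :: "'a::euclidean_space \<Rightarrow> 'b::euclidean_space" and f :: "'b \<Rightarrow> 'c::euclidean_space"
  assumes "linear P" and "f differentiable (at (b + P x))"
  shows "((\<lambda>x. f (b + P x)) has_derivative
    (\<lambda>v. frechet_derivative f (at (b + P x)) (P v))) (at x)"
proof -
  have "((\<lambda>x. b + P x) has_derivative P) (at x)"
    using has_derivative_add[OF has_derivative_const linear_imp_has_derivative[OF assms(1)]] by simp
  from has_derivative_compose[OF this, of f] assms(2) show ?thesis
    by (simp add: frechet_derivative_works)
qed

text \<open>The derivative of an affine map is the constant \<open>P\<close>: the derivative of the
  composite in direction \<open>v\<close> is the derivative of \<open>f\<close> in the fixed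
  direction \<open>P v\<close>, composed with the same affine map. The induction hypothesis
  therefore applies directly.\<close>

lemma C_k_affine_compose:
  fixes P :: "'a::euclidean_space \<Rightarrow> 'b::euclidean_space" and f :: "'b \<Rightarrow> 'c::euclidean_space"
  assumes "linear P"
  shows "C_k k f \<Longrightarrow> C_k k (\<lambda>x. f (b + P x))"
proof (induction k arbitrary: f)
  case 0
  have "continuous_on UNIV P"
    using assms by (simp add: linear_continuous_on linear_conv_bounded_linear)
  with 0 show ?case
    by (auto intro!: continuous_on_compose2[of UNIV f] continuous_intros)
next
  case (Suc k)
  have d: "((\<lambda>x. f (b + P x)) has_derivative
      (\<lambda>v. frechet_derivative f (at (b + P x)) (P v))) (at x)" for x
    using Suc.prems by (intro has_derivative_affine_compose assms) auto
  have "C_k k (\<lambda>x. frechet_derivative f (at (b + P x)) (P v))" for v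
    using Suc.prems Suc.IH[of "\<lambda>y. frechet_derivative f (at y) (P v)"] by auto
  with d show ?case
    by (auto simp: differentiable_def frechet_derivative_at[OF d, symmetric])
qed

lemma smooth_const: "smooth (\<lambda>x. c)"
  by (simp add: smooth_def C_k_const)

lemma smooth_linear: "linear f \<Longrightarrow> smooth f"
  by (simp add: smooth_def C_k_linear)

lemma smooth_add: "smooth f \<Longrightarrow> smooth g \<Longrightarrow> smooth (\<lambda>x. f x + g x)"
  by (simp add: smooth_def C_k_add)

lemma smooth_scaleR:
  fixes f :: "'a::euclidean_space \<Rightarrow> real" and g :: "'a \<Rightarrow> 'b::euclidean_space"
  shows "smooth f \<Longrightarrow> smooth g \<Longrightarrow> smooth (\<lambda>x. f x *\<^sub>R g x)"
  by (simp add: smooth_def C_k_scaleR)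

lemma smooth_mult:
  fixes f g :: "'a::euclidean_space \<Rightarrow> real"
  shows "smooth f \<Longrightarrow> smooth g \<Longrightarrow> smooth (\<lambda>x. f x * g x)"
  using smooth_scaleR[of f g] by simp

lemma smooth_exp_linear:
  fixes l :: "'a::euclidean_space \<Rightarrow> real"
  shows "linear l \<Longrightarrow> smooth (\<lambda>x. exp (l x))"
  by (simp add: smooth_def C_k_exp_linear)

lemma smooth_affine_compose:
  fixes P :: "'a::euclidean_space \<Rightarrow> 'b::euclidean_space" and f :: "'b \<Rightarrow> 'c::euclidean_space"
  shows "linear P \<Longrightarrow> smooth f \<Longrightarrow> smooth (\<lambda>x. f (b + P x))"
  by (simp add: smooth_def C_k_affine_compose)

section \<open>The Levi-Civita connection in coordinates\<close>

lemma linear_axis_expansion: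
  fixes f :: "real^'n::finite \<Rightarrow> 'b::real_vector"
  assumes "linear f"
  shows "f x = (\<Sum>i\<in>UNIV. x $ i *\<^sub>R f (axis i 1))"
proof -
  have "f x = f (\<Sum>i\<in>UNIV. x $ i *\<^sub>R axis i 1)"
    using basis_expansion[of x] by (simp add: scalar_mult_eq_scaleR)
  then show ?thesis
    by (simp add: linear_sum[OF assms] linear_scale[OF assms])
qed

lemma linear_eq_axis:
  fixes f g :: "real^'n::finite \<Rightarrow> 'b::real_vector"
  assumes "linear f" "linear g" "\<And>i. f (axis i 1) = g (axis i 1)"
  shows "f x = g x"
  by (simp add: linear_axis_expansion[OF assms(1), of x] linear_axis_expansion[OF assms(2), of x] assms(3))

lemma matrix_mult_matrix_inv:
  fixes M :: "real^'n^'n"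
  assumes "invertible M"
  shows "M ** matrix_inv M = mat 1" "matrix_inv M ** M = mat 1"
proof -
  have "\<exists>N. M ** N = mat 1 \<and> N ** M = mat 1"
    using assms by (simp add: invertible_def)
  from someI_ex[OF this] show "M ** matrix_inv M = mat 1" "matrix_inv M ** M = mat 1"
    unfolding matrix_inv_def by auto
qed

lemma matrix_inv_eqI:
  fixes M :: "real^'n^'n"
  assumes "M ** N = mat 1"
  shows "matrix_inv M = N"
proof -
  have "invertible M"
    using assms by (auto simp: invertible_right_inverse)
  then have "matrix_inv M = matrix_inv M ** (M ** N)"
    by (simp add: assms)
  also have "\<dots> = N"
    using \<open>invertible M\<close> by (simp add: matrix_mul_assoc matrix_mult_matrix_inv)
  finally show ?thesis .
qed

section \<open>Nondegeneracy, invertibility and derivatives of a Riemannian metric\<close>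

context
  fixes g :: "'n::finite tensor2"
  assumes g: "riemannian_metric g"
begin

lemma metric_bilinear: "bilinear (g p)"
  and metric_sym: "g p u v = g p v u"
  and metric_pos: "u \<noteq> 0 \<Longrightarrow> g p u u > 0"
  and metric_smooth: "smooth (\<lambda>p. g p u v)"
  using g by (auto simp: riemannian_metric_def)

lemma metric_linear: "linear (g p u)" "linear (\<lambda>u. g p u v)"
  using metric_bilinear[of p] by (auto simp: bilinear_def)

lemma metric_differentiable: "(\<lambda>p. g p u v) differentiable (at p)"
  by (intro smooth_imp_differentiable metric_smooth)

lemma metric_nondegenerate:
  assumes "\<And>w. g p u w = g p v w"
  shows "u = v"
proof (rule ccontr)
  assume "u \<noteq> v"
  then have "g p (u - v) (u - v) > 0" by (simp add: metric_pos)
  moreover have "g p (u - v) (u - v) = 0"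
    using assms[of "u - v"] linear_diff[OF metric_linear(2)] by simp
  ultimately show False by simp
qed

lemma metric_components: "g p u v = (\<Sum>i\<in>UNIV. \<Sum>j\<in>UNIV. u $ i * (v $ j * lower g p $ i $ j))"
  by (subst linear_axis_expansion[OF metric_linear(2)], subst linear_axis_expansion[OF metric_linear(1)])
    (simp add: lower_def sum_distrib_left)

text \<open>A kernel vector \<open>x\<close> of the Gram matrix would satisfy
  \<open>g p x x = 0\<close>, against positivity.\<close>

lemma invertible_lower: "invertible (lower g p)"
proof -
  have "x = 0" if "lower g p *v x = 0" for x
  proof (rule ccontr)
    assume "x \<noteq> 0"
    have "g p x x = (\<Sum>i\<in>UNIV. x $ i * (lower g p *v x) $ i)"
      by (simp add: metric_components[of p x x] matrix_vector_mult_def sum_distrib_left mult_ac)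
    with that metric_pos[OF \<open>x \<noteq> 0\<close>, of p] show False by simp
  qed
  then show ?thesis
    by (metis invertible_left_inverse matrix_left_invertible_ker)
qed

lemma lower_upper: "lower g p ** upper g p = mat 1" "upper g p ** lower g p = mat 1"
  by (simp_all add: upper_def matrix_mult_matrix_inv invertible_lower)

lemma frechet_metric_linear:
  "linear (\<lambda>u. frechet_derivative (\<lambda>q. g q u w) (at p) v)"
  "linear (\<lambda>w. frechet_derivative (\<lambda>q. g q u w) (at p) v)"
proof -
  have "frechet_derivative (\<lambda>q. g q (x + y) w) (at p) v
      = frechet_derivative (\<lambda>q. g q x w) (at p) v + frechet_derivative (\<lambda>q. g q y w) (at p) v" for x y w
  proof -
    have "((\<lambda>q. g q x w + g q y w) has_derivative (\<lambda>v. frechet_derivative (\<lambda>q. g q x w) (at p) v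
        + frechet_derivative (\<lambda>q. g q y w) (at p) v)) (at p)"
      using metric_differentiable by (intro has_derivative_add) (auto simp: frechet_derivative_works)
    from frechet_derivative_at[OF this, symmetric] show ?thesis
      by (simp add: linear_add[OF metric_linear(2)])
  qed
  moreover have "frechet_derivative (\<lambda>q. g q (c *\<^sub>R x) w) (at p) v
      = c *\<^sub>R frechet_derivative (\<lambda>q. g q x w) (at p) v" for x w c
  proof -
    have "((\<lambda>q. c *\<^sub>R g q x w) has_derivative (\<lambda>v. c *\<^sub>R frechet_derivative (\<lambda>q. g q x w) (at p) v)) (at p)"
      using metric_differentiable by (intro has_derivative_scaleR_right) (auto simp: frechet_derivative_works)
    from frechet_derivative_at[OF this, symmetric] show ?thesis
      by (simp add: linear_scale[OF metric_linear(2)])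
  qed
  ultimately show 1: "linear (\<lambda>u. frechet_derivative (\<lambda>q. g q u w) (at p) v)" for w
    by (intro linearI) auto
  have "(\<lambda>q. g q u w) = (\<lambda>q. g q w u)" for w
    by (simp add: metric_sym[of _ u w] fun_eq_iff)
  then show "linear (\<lambda>w. frechet_derivative (\<lambda>q. g q u w) (at p) v)"
    using 1[of u] by simp
qed

end

text \<open>The covariant derivative of the constant field \<open>v\<close> in direction
  \<open>u\<close>. Packing the Christoffel symbols into a vector-valued bilinear map allows
  arguments without indices.\<close>

definition chris :: "'n::finite tensor2 \<Rightarrow> real^'n \<Rightarrow> real^'n \<Rightarrow> real^'n \<Rightarrow> real^'n" where
  "chris g p u v = (\<Sum>i\<in>UNIV. \<Sum>j\<in>UNIV. (u $ i * v $ j) *\<^sub>R (\<chi> k. christoffel g k i j p))"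

text \<open>The right-hand side of the Koszul formula for constant fields, whose mutual brackets
  vanish.\<close>

definition koszul :: "'n::finite tensor2 \<Rightarrow> real^'n \<Rightarrow> real^'n \<Rightarrow> real^'n \<Rightarrow> real^'n \<Rightarrow> real" where
  "koszul g p u v w = (frechet_derivative (\<lambda>q. g q v w) (at p) u
     + frechet_derivative (\<lambda>q. g q u w) (at p) v - frechet_derivative (\<lambda>q. g q u v) (at p) w) / 2"

lemma sum_axis_scaleR [simp]:
  fixes f :: "'n::finite \<Rightarrow> 'b::real_vector"
  shows "(\<Sum>i\<in>UNIV. (axis a 1 $ i :: real) *\<^sub>R f i) = f a"
  by (simp add: axis_def if_distrib[where f="\<lambda>x. x *\<^sub>R _"] sum.delta cong: if_cong)

lemma chris_axis: "chris g p (axis i 1) (axis j 1) = (\<chi> k. christoffel g k i j p)"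
  by (simp add: chris_def scaleR_scaleR[symmetric] scaleR_sum_right[symmetric] del: scaleR_scaleR)

lemma chris_linear: "linear (chris g p u)" "linear (\<lambda>u. chris g p u v)"
  by (auto intro!: linearI simp: chris_def algebra_simps sum.distrib scaleR_sum_right)

lemma metric_chris_axis:
  assumes "riemannian_metric g"
  shows "g p (chris g p (axis i 1) (axis j 1)) (axis l 1) = koszul g p (axis i 1) (axis j 1) (axis l 1)"
proof -
  define c where "c m = partial i (\<lambda>q. lower g q $ j $ m) p
         + partial j (\<lambda>q. lower g q $ i $ m) p - partial m (\<lambda>q. lower g q $ i $ j) p" for m
  have "g p (\<chi> k. christoffel g k i j p) (axis l 1)
      = (\<Sum>k\<in>UNIV. christoffel g k i j p * lower g p $ l $ k)"
    by (subst linear_axis_expansion[OF metric_linear(2)[OF assms]])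
      (simp add: lower_def metric_sym[OF assms, of p _ "axis l 1"])
  also have "\<dots> = (\<Sum>k\<in>UNIV. \<Sum>m\<in>UNIV. c m / 2 * (lower g p $ l $ k * upper g p $ k $ m))"
    unfolding christoffel_def c_def[symmetric]
    by (simp add: sum_distrib_left sum_distrib_right mult_ac)
  also have "\<dots> = (\<Sum>m\<in>UNIV. c m / 2 * (lower g p ** upper g p) $ l $ m)"
    by (subst sum.swap) (simp add: matrix_matrix_mult_def sum_distrib_left)
  also have "\<dots> = c l / 2"
    unfolding lower_upper[OF assms] by (simp add: mat_def if_distrib cong: if_cong)
  finally show ?thesis
    by (simp add: chris_axis koszul_def c_def partial_def lower_def)
qed

lemma linear_divide: "linear f \<Longrightarrow> linear (\<lambda>x. f x / (c::real))"
  by (auto simp: linear_iff add_divide_distrib)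

text \<open>Both sides are trilinear, so the case of basis vectors, where the inverse metric cancels
  against the metric, is enough. Together with nondegeneracy this characterises \<open>chris\<close>
  without coordinates.\<close>

lemma metric_chris:
  assumes "riemannian_metric g"
  shows "g p (chris g p u v) w = koszul g p u v w"
proof -
  note lin = metric_linear[OF assms] chris_linear frechet_metric_linear[OF assms]
  have lin_fd: "linear (frechet_derivative (\<lambda>q. g q x y) (at p))" for x y
    by (intro linear_frechet_derivative metric_differentiable assms)
  have k1: "linear (\<lambda>u. koszul g p u v w)" for v w
    unfolding koszul_def by (intro linear_divide linear_compose_sub linear_compose_add lin lin_fd)
  have k2: "linear (\<lambda>v. koszul g p u v w)" for u w
    unfolding koszul_def by (intro linear_divide linear_compose_sub linear_compose_add lin lin_fd)
  have k3: "linear (\<lambda>w. koszul g p u v w)" for u v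
    unfolding koszul_def by (intro linear_divide linear_compose_sub linear_compose_add lin lin_fd)
  have m1: "linear (\<lambda>u. g p (chris g p u v) w)" for v w
    using linear_compose[OF chris_linear(2) metric_linear(2)[OF assms]] by (simp add: o_def)
  have m2: "linear (\<lambda>v. g p (chris g p u v) w)" for u w
    using linear_compose[OF chris_linear(1) metric_linear(2)[OF assms]] by (simp add: o_def)
  have "g p (chris g p (axis i 1) (axis j 1)) w = koszul g p (axis i 1) (axis j 1) w" for i j
    by (rule linear_eq_axis[OF metric_linear(1)[OF assms] k3 metric_chris_axis[OF assms]])
  then have "g p (chris g p (axis i 1) v) w = koszul g p (axis i 1) v w" for i
    by (rule linear_eq_axis[OF m2 k2])
  then show ?thesis
    by (rule linear_eq_axis[OF m1 k1])
qed

section \<open>Curvature as a multilinear map\<close>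

text \<open>Kept as a separate hypothesis because \<open>chris\<close> involves the inverse matrix
  of the metric. An explicit formula settles it for \<open>heis_metric\<close>, and pullback along
  affine bijections preserves it.\<close>

definition chris_differentiable :: "'n::finite tensor2 \<Rightarrow> bool" where
  "chris_differentiable g \<longleftrightarrow> (\<forall>u v p. (\<lambda>q. chris g q u v) differentiable (at p))"

text \<open>The curvature R(u,v)w for constant fields; the term with the bracket of \<open>u\<close>
  and \<open>v\<close> vanishes.\<close>

definition curv :: "'n::finite tensor2 \<Rightarrow> real^'n \<Rightarrow> real^'n \<Rightarrow> real^'n \<Rightarrow> real^'n \<Rightarrow> real^'n" where
  "curv g p u v w = frechet_derivative (\<lambda>q. chris g q v w) (at p) u
     - frechet_derivative (\<lambda>q. chris g q u w) (at p) v
     + chris g p u (chris g p v w) - chris g p v (chris g p u w)"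

lemma chris_has_derivative:
  assumes "chris_differentiable g"
  shows "((\<lambda>q. chris g q u v) has_derivative frechet_derivative (\<lambda>q. chris g q u v) (at p)) (at p)"
  using assms by (auto simp: chris_differentiable_def frechet_derivative_works)

lemma frechet_chris_linear:
  assumes "chris_differentiable g"
  shows "linear (frechet_derivative (\<lambda>q. chris g q u v) (at p))"
    and "linear (\<lambda>u. frechet_derivative (\<lambda>q. chris g q u v) (at p) w)"
    and "linear (\<lambda>v. frechet_derivative (\<lambda>q. chris g q u v) (at p) w)"
proof -
  note d = chris_has_derivative[OF assms]
  show "linear (frechet_derivative (\<lambda>q. chris g q u v) (at p))"
    by (rule has_derivative_linear[OF d])
  show "linear (\<lambda>u. frechet_derivative (\<lambda>q. chris g q u v) (at p) w)"
    using frechet_derivative_at[OF has_derivative_add[OF d d], symmetric]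
      frechet_derivative_at[OF has_derivative_scaleR_right[OF d], symmetric]
    by (intro linearI) (simp_all add: linear_add[OF chris_linear(2)] linear_scale[OF chris_linear(2)])
  show "linear (\<lambda>v. frechet_derivative (\<lambda>q. chris g q u v) (at p) w)"
    using frechet_derivative_at[OF has_derivative_add[OF d d], symmetric]
      frechet_derivative_at[OF has_derivative_scaleR_right[OF d], symmetric]
    by (intro linearI) (simp_all add: linear_add[OF chris_linear(1)] linear_scale[OF chris_linear(1)])
qed

lemma curv_linear:
  assumes "chris_differentiable g"
  shows "linear (\<lambda>u. curv g p u v w)" "linear (\<lambda>v. curv g p u v w)" "linear (\<lambda>w. curv g p u v w)"
proof -
  note fl = frechet_chris_linear[OF assms]
  have c2: "linear (\<lambda>x. chris g p y (f x))" "linear (\<lambda>x. chris g p (f x) y)" if "linear f" for f y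
    using linear_compose[OF that chris_linear(1)] linear_compose[OF that chris_linear(2)]
    by (simp_all add: o_def)
  show "linear (\<lambda>u. curv g p u v w)" "linear (\<lambda>v. curv g p u v w)" "linear (\<lambda>w. curv g p u v w)"
    unfolding curv_def
    by (intro linear_compose_sub linear_compose_add fl c2 chris_linear)+
qed

lemma partial_christoffel:
  assumes "chris_differentiable g"
  shows "partial i (christoffel g l j k) p
    = frechet_derivative (\<lambda>q. chris g q (axis j 1) (axis k 1)) (at p) (axis i 1) $ l"
proof -
  have "((\<lambda>q. chris g q (axis j 1) (axis k 1) $ l) has_derivative
      (\<lambda>v. frechet_derivative (\<lambda>q. chris g q (axis j 1) (axis k 1)) (at p) v $ l)) (at p)"
    by (intro bounded_linear.has_derivative[OF bounded_linear_vec_nth] chris_has_derivative assms)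
  moreover have "(\<lambda>q. chris g q (axis j 1) (axis k 1) $ l) = christoffel g l j k"
    by (simp add: chris_axis fun_eq_iff)
  ultimately show ?thesis
    by (simp add: partial_def frechet_derivative_at[symmetric])
qed

lemma riemann_up_eq_curv:
  assumes "chris_differentiable g"
  shows "riemann_up g i j k l p = curv g p (axis i 1) (axis j 1) (axis k 1) $ l"
proof -
  have "chris g p (axis a 1) (chris g p (axis b 1) (axis k 1)) $ l
      = (\<Sum>m\<in>UNIV. christoffel g m b k p * christoffel g l a m p)" for a b
    by (subst linear_axis_expansion[OF chris_linear(1)]) (simp add: chris_axis)
  then show ?thesis
    by (simp add: riemann_up_def curv_def partial_christoffel[OF assms] sum_subtractf)
qed

lemma Rm_eq_curv:
  assumes "riemannian_metric g" "chris_differentiable g"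
  shows "Rm g i j k l p = g p (curv g p (axis i 1) (axis j 1) (axis k 1)) (axis l 1)"
  by (subst linear_axis_expansion[OF metric_linear(2)[OF assms(1)]])
    (simp add: Rm_def riemann_up_eq_curv[OF assms(2)] lower_def)

text \<open>Exhibits Ricci as the trace of the endomorphism sending \<open>x\<close> to
  \<open>curv g p x u v\<close>, a form in which invariance under conjugation can be used.\<close>

lemma Rc_eq_curv:
  assumes "chris_differentiable g"
  shows "Rc g p u v = (\<Sum>i\<in>UNIV. curv g p (axis i 1) u v $ i)"
proof -
  have "curv g p (axis i 1) u v
      = (\<Sum>j\<in>UNIV. \<Sum>k\<in>UNIV. (u $ j * v $ k) *\<^sub>R curv g p (axis i 1) (axis j 1) (axis k 1))" for i
    by (subst linear_axis_expansion[OF curv_linear(2)[OF assms]],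
        subst linear_axis_expansion[OF curv_linear(3)[OF assms]])
      (simp add: scaleR_sum_right)
  then have "(\<Sum>i\<in>UNIV. curv g p (axis i 1) u v $ i) = (\<Sum>i\<in>UNIV. \<Sum>j\<in>UNIV. \<Sum>k\<in>UNIV.
      u $ j * v $ k * riemann_up g i j k i p)"
    by (simp add: riemann_up_eq_curv[OF assms])
  also have "\<dots> = (\<Sum>j\<in>UNIV. \<Sum>i\<in>UNIV. \<Sum>k\<in>UNIV. u $ j * v $ k * riemann_up g i j k i p)"
    by (rule sum.swap)
  also have "\<dots> = (\<Sum>j\<in>UNIV. \<Sum>k\<in>UNIV. \<Sum>i\<in>UNIV. u $ j * v $ k * riemann_up g i j k i p)"
    by (intro sum.cong refl sum.swap)
  finally show ?thesis
    by (simp add: Rc_def of_components_def sum_distrib_left sum_distrib_right mult_ac)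
qed

section \<open>Metric traces and the quadratic curvature tensor\<close>

definition contraction :: "real^'n^'n \<Rightarrow> (real^'n::finite \<Rightarrow> real^'n \<Rightarrow> real) \<Rightarrow> real" where
  "contraction U F = (\<Sum>k\<in>UNIV. \<Sum>a\<in>UNIV. U $ k $ a * F (axis k 1) (axis a 1))"

lemma contraction_linear:
  assumes "\<And>x y. linear (\<lambda>u. F u x y)"
  shows "linear (\<lambda>u. contraction U (F u))"
  by (intro linearI) (simp_all add: contraction_def linear_add[OF assms] linear_scale[OF assms]
      sum.distrib sum_distrib_left algebra_simps)

text \<open>Substituting \<open>P\<close> into both slots of a bilinear form amounts to a change of
  basis, which moves onto the coefficient matrix as a congruence.\<close>

lemma contraction_congruence:
  fixes P :: "real^'n::finite \<Rightarrow> real^'n"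
  assumes "linear P" "bilinear F"
  shows "contraction U (\<lambda>x y. F (P x) (P y)) = contraction (matrix P ** U ** transpose (matrix P)) F"
proof -
  have "F (P (axis k 1)) (P (axis a 1))
      = (\<Sum>m\<in>UNIV. \<Sum>n\<in>UNIV. matrix P $ m $ k * (matrix P $ n $ a * F (axis m 1) (axis n 1)))" for k a
  proof -
    have F: "linear (\<lambda>x. F x y)" "linear (F x)" for x y
      using assms(2) by (auto simp: bilinear_def)
    show ?thesis
      by (subst linear_axis_expansion[OF F(1)], subst linear_axis_expansion[OF F(2)])
        (simp add: matrix_def sum_distrib_left)
  qed
  \<comment> \<open>The four sums are now reordered until \<open>m\<close> and \<open>n\<close> are
    outermost; the inner sums over \<open>k\<close> and \<open>a\<close> are then the entries of the
    congruent matrix.\<close>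
  then have "contraction U (\<lambda>x y. F (P x) (P y)) = (\<Sum>k\<in>UNIV. \<Sum>a\<in>UNIV. \<Sum>m\<in>UNIV. \<Sum>n\<in>UNIV.
      matrix P $ m $ k * U $ k $ a * matrix P $ n $ a * F (axis m 1) (axis n 1))"
    by (simp add: contraction_def sum_distrib_left mult_ac)
  also have "\<dots> = (\<Sum>k\<in>UNIV. \<Sum>m\<in>UNIV. \<Sum>a\<in>UNIV. \<Sum>n\<in>UNIV.
      matrix P $ m $ k * U $ k $ a * matrix P $ n $ a * F (axis m 1) (axis n 1))"
    by (intro sum.cong refl sum.swap)
  also have "\<dots> = (\<Sum>m\<in>UNIV. \<Sum>k\<in>UNIV. \<Sum>a\<in>UNIV. \<Sum>n\<in>UNIV.
      matrix P $ m $ k * U $ k $ a * matrix P $ n $ a * F (axis m 1) (axis n 1))"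
    by (rule sum.swap)
  also have "\<dots> = (\<Sum>m\<in>UNIV. \<Sum>k\<in>UNIV. \<Sum>n\<in>UNIV. \<Sum>a\<in>UNIV.
      matrix P $ m $ k * U $ k $ a * matrix P $ n $ a * F (axis m 1) (axis n 1))"
    by (intro sum.cong refl sum.swap)
  also have "\<dots> = (\<Sum>m\<in>UNIV. \<Sum>n\<in>UNIV. \<Sum>k\<in>UNIV. \<Sum>a\<in>UNIV.
      matrix P $ m $ k * U $ k $ a * matrix P $ n $ a * F (axis m 1) (axis n 1))"
    by (intro sum.cong refl sum.swap)
  also have "\<dots> = (\<Sum>m\<in>UNIV. \<Sum>n\<in>UNIV. \<Sum>a\<in>UNIV. \<Sum>k\<in>UNIV.
      matrix P $ m $ k * U $ k $ a * matrix P $ n $ a * F (axis m 1) (axis n 1))"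
    by (intro sum.cong refl sum.swap)
  also have "\<dots> = contraction (matrix P ** U ** transpose (matrix P)) F"
    by (simp add: contraction_def matrix_matrix_mult_def transpose_def sum_distrib_right)
  finally show ?thesis .
qed

text \<open>Grouping the six indices into the pairs joined by the inverse metric gives three nested
  traces, so that a change of variables can treat one pair at a time.\<close>

lemma Rm_squared_eq_contraction:
  assumes g: "riemannian_metric g" and d: "chris_differentiable g"
  shows "Rm_squared g p u v = contraction (upper g p) (\<lambda>k a. contraction (upper g p) (\<lambda>l b.
      contraction (upper g p) (\<lambda>m c. g p (curv g p u k l) m * g p (curv g p v a b) c)))"
    (is "_ = ?S u v")
proof -
  let ?U = "upper g p"
  have lin: "linear (\<lambda>u. g p (curv g p u k l) m)" for k l m
    using linear_compose[OF curv_linear(1)[OF d] metric_linear(2)[OF g]] by (simp add: o_def)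
  have lin2: "linear (\<lambda>u. g p (curv g p u k l) m * y)" "linear (\<lambda>u. y * g p (curv g p u k l) m)" for k l m y
    by (auto intro!: linearI simp: linear_add[OF lin] linear_scale[OF lin] algebra_simps)
  have S: "linear (\<lambda>u. ?S u v)" "linear (?S u)" for u v
    by (intro contraction_linear lin2)+
  have "(\<Sum>k\<in>UNIV. \<Sum>l\<in>UNIV. \<Sum>m\<in>UNIV. \<Sum>a\<in>UNIV. \<Sum>b\<in>UNIV. \<Sum>c\<in>UNIV.
       Rm g i k l m p * Rm g j a b c p * ?U $ k $ a * ?U $ l $ b * ?U $ m $ c)
      = ?S (axis i 1) (axis j 1)"
    (is "(\<Sum>k\<in>UNIV. \<Sum>l\<in>UNIV. \<Sum>m\<in>UNIV. \<Sum>a\<in>UNIV. \<Sum>b\<in>UNIV. ?X k l m a b) = _") for i j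
  proof -
    have "(\<Sum>k\<in>UNIV. \<Sum>l\<in>UNIV. \<Sum>m\<in>UNIV. \<Sum>a\<in>UNIV. \<Sum>b\<in>UNIV. ?X k l m a b)
      = (\<Sum>k\<in>UNIV. \<Sum>l\<in>UNIV. \<Sum>a\<in>UNIV. \<Sum>m\<in>UNIV. \<Sum>b\<in>UNIV. ?X k l m a b)"
      by (intro sum.cong refl sum.swap)
    also have "\<dots> = (\<Sum>k\<in>UNIV. \<Sum>a\<in>UNIV. \<Sum>l\<in>UNIV. \<Sum>m\<in>UNIV. \<Sum>b\<in>UNIV. ?X k l m a b)"
      by (intro sum.cong refl sum.swap)
    also have "\<dots> = (\<Sum>k\<in>UNIV. \<Sum>a\<in>UNIV. \<Sum>l\<in>UNIV. \<Sum>b\<in>UNIV. \<Sum>m\<in>UNIV. ?X k l m a b)"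
      by (intro sum.cong refl sum.swap)
    finally show ?thesis
      by (simp add: contraction_def Rm_eq_curv[OF g d] sum_distrib_left mult_ac)
  qed
  then have "Rm_squared g p u v = (\<Sum>i\<in>UNIV. \<Sum>j\<in>UNIV. ?S (axis i 1) (axis j 1) * u $ i * v $ j)"
    by (simp add: Rm_squared_def of_components_def)
  also have "\<dots> = ?S u v"
    unfolding linear_axis_expansion[OF S(1), of u v]
    by (intro sum.cong refl, subst (2) linear_axis_expansion[OF S(2)])
      (simp add: sum_distrib_left mult_ac)
  finally show ?thesis .
qed

section \<open>Naturality under affine maps\<close>

context
  fixes g h :: "'n::finite tensor2" and b :: "real^'n" and P Q :: "real^'n \<Rightarrow> real^'n"
  assumes h: "riemannian_metric h"
    and P: "linear P" and Q: "linear Q"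
    and PQ: "\<And>x. P (Q x) = x" and QP: "\<And>x. Q (P x) = x"
    and g_eq: "g = (\<lambda>p u v. h (b + P p) (P u) (P v))"
begin

lemma riemannian_affine_pullback: "riemannian_metric g"
proof -
  have "P u \<noteq> 0" if "u \<noteq> 0" for u
    using that QP[of u] linear_0[OF Q] by auto
  moreover have "bilinear (\<lambda>u v. h x (P u) (P v))" for x
    using linear_compose[OF P metric_linear(1)[OF h]] linear_compose[OF P metric_linear(2)[OF h]]
    by (auto simp: bilinear_def o_def)
  ultimately show ?thesis
    unfolding riemannian_metric_def g_eq
    by (auto simp: metric_pos[OF h] metric_sym[OF h]
        intro: smooth_affine_compose[OF P metric_smooth[OF h]])
qed

text \<open>This is where affineness matters: the derivative of the map is constant, so
  differentiating the pulled-back metric produces no second-derivative terms.\<close>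

lemma koszul_affine_pullback: "koszul g p u v w = koszul h (b + P p) (P u) (P v) (P w)"
  by (simp add: koszul_def g_eq frechet_derivative_at[symmetric,
        OF has_derivative_affine_compose[OF P metric_differentiable[OF h]]])

lemma chris_affine_pullback: "chris g p u v = Q (chris h (b + P p) (P u) (P v))"
proof -
  have "h (b + P p) (P (chris g p u v)) w = h (b + P p) (chris h (b + P p) (P u) (P v)) w" for w
  proof -
    \<comment> \<open>The test vector \<open>Q w\<close> is chosen so that \<open>P\<close> turns it
      into the arbitrary vector \<open>w\<close>.\<close>
    have "h (b + P p) (P (chris g p u v)) (P (Q w)) = koszul g p u v (Q w)"
      using metric_chris[OF riemannian_affine_pullback] by (simp add: g_eq)
    then show ?thesis
      by (simp add: koszul_affine_pullback metric_chris[OF h] PQ)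
  qed
  then have "P (chris g p u v) = chris h (b + P p) (P u) (P v)"
    by (rule metric_nondegenerate[OF h])
  then show ?thesis using QP by metis
qed

context
  assumes d: "chris_differentiable h"
begin

lemma chris_affine_pullback_has_derivative:
  "((\<lambda>q. chris g q u v) has_derivative
    (\<lambda>w. Q (frechet_derivative (\<lambda>q. chris h q (P u) (P v)) (at (b + P p)) (P w)))) (at p)"
proof -
  have "(\<lambda>q. chris h q (P u) (P v)) differentiable (at (b + P p))"
    using d by (simp add: chris_differentiable_def)
  from has_derivative_affine_compose[OF P this]
  show ?thesis
    unfolding chris_affine_pullback
    by (rule bounded_linear.has_derivative[OF linear_conv_bounded_linear[THEN iffD1, OF Q]])
qed

lemma chris_differentiable_affine_pullback: "chris_differentiable g"
  using chris_affine_pullback_has_derivative by (auto simp: chris_differentiable_def differentiable_def)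

lemma curv_affine_pullback: "curv g p u v w = Q (curv h (b + P p) (P u) (P v) (P w))"
  unfolding curv_def frechet_derivative_at[OF chris_affine_pullback_has_derivative, symmetric]
  by (simp add: chris_affine_pullback PQ linear_add[OF Q] linear_diff[OF Q])

lemma matrix_PQ: "matrix P ** matrix Q = mat 1" "matrix Q ** matrix P = mat 1"
  by (simp_all add: matrix_compose[OF Q P, symmetric] matrix_compose[OF P Q, symmetric]
      o_def PQ QP matrix_id_mat_1[unfolded id_def])

text \<open>The two curvature endomorphisms are conjugate by \<open>P\<close>, and the trace is
  invariant under conjugation.\<close>

lemma Rc_affine_pullback: "Rc g p u v = Rc h (b + P p) (P u) (P v)"
proof -
  define L where "L x = curv h (b + P p) x (P u) (P v)" for x
  have L: "linear L"
    unfolding L_def by (rule curv_linear[OF d])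
  have tr: "(\<Sum>i\<in>UNIV. f (axis i 1) $ i) = trace (matrix f)" for f :: "real^'n \<Rightarrow> real^'n"
    by (simp add: trace_def matrix_def)
  have "Rc g p u v = trace (matrix (Q \<circ> (L \<circ> P)))"
    by (simp add: Rc_eq_curv[OF chris_differentiable_affine_pullback] curv_affine_pullback
        L_def tr[symmetric])
  also have "\<dots> = trace (matrix Q ** (matrix L ** matrix P))"
    by (simp add: matrix_compose linear_compose L P Q)
  also have "\<dots> = trace (matrix L)"
    by (subst trace_mul_sym) (simp add: matrix_mul_assoc[symmetric] matrix_PQ)
  also have "\<dots> = Rc h (b + P p) (P u) (P v)"
    by (simp add: Rc_eq_curv[OF d] L_def tr[symmetric])
  finally show ?thesis .
qed

text \<open>The Gram matrix changes by the congruence with \<open>P\<close>, so its inverse changes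
  by the congruence with \<open>Q\<close>, and the outer factors of \<open>P\<close> undo
  this.\<close>

lemma upper_affine_pullback:
  "matrix P ** upper g p ** transpose (matrix P) = upper h (b + P p)"
proof -
  let ?P = "matrix P" and ?Q = "matrix Q" and ?L = "lower h (b + P p)"
  have col: "P (axis i 1) = (\<Sum>k\<in>UNIV. ?P $ k $ i *\<^sub>R axis k 1)" for i
    using basis_expansion[of "P (axis i 1)"] by (simp add: matrix_def scalar_mult_eq_scaleR)
  have "lower g p $ i $ j = (transpose ?P ** ?L ** ?P) $ i $ j" for i j
  proof -
    have "lower g p $ i $ j = (\<Sum>k\<in>UNIV. \<Sum>l\<in>UNIV. ?P $ k $ i * (?P $ l $ j * ?L $ k $ l))"
      by (simp add: lower_def g_eq metric_components[OF h, of _ "P _"] matrix_def)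
    also have "\<dots> = (\<Sum>l\<in>UNIV. \<Sum>k\<in>UNIV. ?P $ k $ i * (?P $ l $ j * ?L $ k $ l))"
      by (rule sum.swap)
    finally show ?thesis
      by (simp add: matrix_matrix_mult_def transpose_def sum_distrib_left sum_distrib_right mult_ac)
  qed
  then have low: "lower g p = transpose ?P ** ?L ** ?P"
    by (simp add: vec_eq_iff)
  have tPQ: "transpose ?P ** transpose ?Q = mat 1"
    by (simp add: matrix_transpose_mul[symmetric] matrix_PQ)
  have "lower g p ** (?Q ** upper h (b + P p) ** transpose ?Q)
      = transpose ?P ** (?L ** ((?P ** ?Q) ** upper h (b + P p))) ** transpose ?Q"
    by (simp add: low matrix_mul_assoc)
  also have "\<dots> = mat 1"
    by (simp add: matrix_PQ lower_upper[OF h] tPQ)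
  finally have "upper g p = ?Q ** upper h (b + P p) ** transpose ?Q"
    unfolding upper_def[of g] by (rule matrix_inv_eqI)
  then have "?P ** upper g p ** transpose ?P
      = (?P ** ?Q) ** upper h (b + P p) ** (transpose ?Q ** transpose ?P)"
    by (simp add: matrix_mul_assoc)
  also have "\<dots> = upper h (b + P p)"
    by (simp add: matrix_PQ matrix_transpose_mul[symmetric])
  finally show ?thesis .
qed

lemma contraction_affine_pullback:
  assumes "bilinear F"
  shows "contraction (upper g p) (\<lambda>x y. F (P x) (P y)) = contraction (upper h (b + P p)) F"
  by (simp add: contraction_congruence[OF P assms] upper_affine_pullback)

text \<open>Once the curvature is expressed through \<open>R\<close>, each of the three traces
  absorbs its two copies of \<open>P\<close>, starting from the innermost pair.\<close>

lemma Rm_squared_affine_pullback: "Rm_squared g p u v = Rm_squared h (b + P p) (P u) (P v)"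
proof -
  let ?p = "b + P p"
  define R where "R u k l m = h ?p (curv h ?p u k l) m" for u k l m
  have R: "linear (\<lambda>k. R u k l m)" "linear (\<lambda>l. R u k l m)" "linear (\<lambda>m. R u k l m)" for u k l m
    using linear_compose[OF curv_linear(2)[OF d] metric_linear(2)[OF h]]
      linear_compose[OF curv_linear(3)[OF d] metric_linear(2)[OF h]] metric_linear(1)[OF h]
    by (simp_all add: R_def o_def)
  have R2: "linear (\<lambda>k. R u k l m * y)" "linear (\<lambda>l. R u k l m * y)" "linear (\<lambda>m. R u k l m * y)"
    "linear (\<lambda>k. y * R u k l m)" "linear (\<lambda>l. y * R u k l m)" "linear (\<lambda>m. y * R u k l m)" for u k l m y
    by (auto intro!: linearI simp: linear_add[OF R(1)] linear_scale[OF R(1)] linear_add[OF R(2)]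
        linear_scale[OF R(2)] linear_add[OF R(3)] linear_scale[OF R(3)] algebra_simps)
  have gR: "g p (curv g p u k l) m = R (P u) (P k) (P l) (P m)" for u k l m
    unfolding curv_affine_pullback by (simp add: g_eq PQ R_def)
  have "Rm_squared g p u v = contraction (upper g p) (\<lambda>k a. contraction (upper g p) (\<lambda>l c.
      contraction (upper g p) (\<lambda>m e. R (P u) (P k) (P l) (P m) * R (P v) (P a) (P c) (P e))))"
    by (simp add: Rm_squared_eq_contraction[OF riemannian_affine_pullback
          chris_differentiable_affine_pullback] gR)
  also have "\<dots> = contraction (upper g p) (\<lambda>k a. contraction (upper g p) (\<lambda>l c.
      contraction (upper h ?p) (\<lambda>m e. R (P u) (P k) (P l) m * R (P v) (P a) (P c) e)))"
    by (subst contraction_affine_pullback) (auto simp: bilinear_def intro: R2)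
  also have "\<dots> = contraction (upper g p) (\<lambda>k a. contraction (upper h ?p) (\<lambda>l c.
      contraction (upper h ?p) (\<lambda>m e. R (P u) (P k) l m * R (P v) (P a) c e)))"
    by (subst contraction_affine_pullback[of "\<lambda>l c. contraction (upper h ?p)
        (\<lambda>m e. R (P u) (P _) l m * R (P v) (P _) c e)"])
      (unfold bilinear_def, (intro conjI allI contraction_linear R2 refl)+)
  also have "\<dots> = contraction (upper h ?p) (\<lambda>k a. contraction (upper h ?p) (\<lambda>l c.
      contraction (upper h ?p) (\<lambda>m e. R (P u) k l m * R (P v) a c e)))"
    by (rule contraction_affine_pullback) (unfold bilinear_def, intro conjI allI contraction_linear R2)
  also have "\<dots> = Rm_squared h ?p (P u) (P v)"
    by (simp add: Rm_squared_eq_contraction[OF h d] R_def)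
  finally show ?thesis .
qed

lemma RG_affine_pullback: "RG \<alpha> g p u v = RG \<alpha> h (b + P p) (P u) (P v)"
  by (simp add: RG_def Rc_affine_pullback Rm_squared_affine_pullback)

end

end

section \<open>Curvature of the standard left invariant metric\<close>

text \<open>The coefficient of the central basis vector in the Lie bracket.\<close>

definition heis_form :: "real^3 \<Rightarrow> real^3 \<Rightarrow> real" where
  "heis_form x y = x $ 2 * y $ 3 - x $ 3 * y $ 2"

text \<open>The left invariant contact form; its value is the first coordinate of \<open>u\<close>
  after \<open>q\<close> has been translated back to the origin.\<close>

definition heis_theta :: "real^3 \<Rightarrow> real^3 \<Rightarrow> real" where
  "heis_theta q u = u $ 1 - heis_form q u / 2"

definition heis_metric :: "real \<Rightarrow> 3 tensor2" where
  "heis_metric A q u v = A * heis_theta q u * heis_theta q v + u $ 2 * v $ 2 + u $ 3 * v $ 3"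

lemma heis_form_linear: "linear (heis_form x)" "linear (\<lambda>x. heis_form x y)"
  by (auto intro!: linearI simp: heis_form_def algebra_simps)

lemma heis_theta_linear: "linear (heis_theta q)"
  by (auto intro!: linearI simp: heis_theta_def heis_form_def algebra_simps add_divide_distrib diff_divide_distrib)

lemma heis_theta_has_derivative:
  "((\<lambda>q. heis_theta q u) has_derivative (\<lambda>w. - heis_form w u / 2)) (at p)"
proof -
  have "((\<lambda>q. u $ 1 + - 1 / 2 * heis_form q u) has_derivative (\<lambda>w. - 1 / 2 * heis_form w u)) (at p)"
    using linear_imp_has_derivative[OF heis_form_linear(2), of u "at p"]
    by (auto intro!: derivative_eq_intros)
  then show ?thesis
    by (simp add: heis_theta_def)
qed

lemma heis_theta_smooth: "smooth (\<lambda>q. heis_theta q u)"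
proof -
  have "smooth (\<lambda>q. u $ 1 + (- 1 / 2) * heis_form q u)"
    by (intro smooth_add smooth_mult smooth_const smooth_linear heis_form_linear)
  then show ?thesis by (simp add: heis_theta_def)
qed

lemma riemannian_heis_metric:
  assumes "A > 0"
  shows "riemannian_metric (heis_metric A)"
proof -
  have "heis_metric A p u u > 0" if "u \<noteq> 0" for p u
  \<comment> \<open>If \<open>u\<close> has no horizontal part, \<open>heis_theta p u\<close> is its
    first coordinate and must be nonzero; otherwise the last two squares are already
    positive.\<close>
  proof (cases "u $ 2 = 0 \<and> u $ 3 = 0")
    case True
    then have "u $ 1 \<noteq> 0"
      using that by (auto simp: vec_eq_iff forall_3)
    with True assms show ?thesis
      by (simp add: heis_metric_def heis_theta_def heis_form_def power2_eq_square[symmetric] mult.assoc)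
  next
    case False
    then have "(u $ 2)\<^sup>2 + (u $ 3)\<^sup>2 > 0"
      by (auto simp: sum_power2_gt_zero_iff)
    moreover have "A * (heis_theta p u)\<^sup>2 \<ge> 0"
      using assms by simp
    ultimately show ?thesis
      by (simp add: heis_metric_def power2_eq_square mult.assoc)
  qed
  moreover have "bilinear (heis_metric A p)" for p
    unfolding bilinear_def heis_metric_def
    by (auto intro!: linearI simp: linear_add[OF heis_theta_linear] linear_scale[OF heis_theta_linear]
        algebra_simps)
  moreover have "smooth (\<lambda>p. heis_metric A p u v)" for u v
    unfolding heis_metric_def by (intro smooth_add smooth_mult smooth_const heis_theta_smooth)
  ultimately show ?thesis
    by (auto simp: riemannian_metric_def) (simp add: heis_metric_def)
qed

text \<open>The vector dual to the bracket form: it lies in the kernel of \<open>heis_theta q\<close>, and its inner product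
  with \<open>w\<close> is \<open>heis_form w u / 2\<close>.\<close>

definition heis_rot :: "real^3 \<Rightarrow> real^3 \<Rightarrow> real^3" where
  "heis_rot q u = (- (q $ 2 * u $ 2 + q $ 3 * u $ 3) / 4) *\<^sub>R axis 1 1
     + (u $ 3 / 2) *\<^sub>R axis 2 1 - (u $ 2 / 2) *\<^sub>R axis 3 1"

lemma axis_nth_3 [simp]:
  "axis (1::3) (x::real) $ 1 = x" "axis (1::3) (x::real) $ 2 = 0" "axis (1::3) (x::real) $ 3 = 0"
  "axis (2::3) (x::real) $ 1 = 0" "axis (2::3) (x::real) $ 2 = x" "axis (2::3) (x::real) $ 3 = 0"
  "axis (3::3) (x::real) $ 1 = 0" "axis (3::3) (x::real) $ 2 = 0" "axis (3::3) (x::real) $ 3 = x"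
  by (simp_all add: axis_def)

text \<open>The two terms containing \<open>heis_theta q w\<close> cancel because
  \<open>heis_form\<close> is antisymmetric. Hence \<open>w\<close> enters only through
  \<open>heis_form\<close>, which \<open>heis_rot\<close> represents.\<close>

lemma koszul_heis_metric:
  "koszul (heis_metric A) q u v w =
    A * (heis_theta q v * heis_form w u + heis_theta q u * heis_form w v) / 2"
proof -
  have "((\<lambda>q. heis_metric A q v w) has_derivative
      (\<lambda>u. - A * (heis_form u v * heis_theta q w + heis_theta q v * heis_form u w) / 2)) (at q)" for v w
    unfolding heis_metric_def
    by (auto intro!: derivative_eq_intros heis_theta_has_derivative simp: algebra_simps)
  note fd = frechet_derivative_at[OF this, symmetric]
  show ?thesis
    unfolding koszul_def fd by (simp add: heis_form_def field_simps)
qed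

lemma chris_heis_metric:
  assumes "A > 0"
  shows "chris (heis_metric A) q u v =
    A *\<^sub>R (heis_theta q v *\<^sub>R heis_rot q u + heis_theta q u *\<^sub>R heis_rot q v)"
proof (rule metric_nondegenerate[OF riemannian_heis_metric[OF assms]])
  fix w
  note lin = metric_linear(2)[OF riemannian_heis_metric[OF assms]]
  have "heis_theta q (heis_rot q u) = 0" for u
    by (simp add: heis_theta_def heis_form_def heis_rot_def field_simps)
  then have rot: "heis_metric A q (heis_rot q u) w = heis_form w u / 2" for u
    by (simp add: heis_metric_def) (simp add: heis_rot_def heis_form_def field_simps)
  show "heis_metric A q (chris (heis_metric A) q u v) w = heis_metric A q
      (A *\<^sub>R (heis_theta q v *\<^sub>R heis_rot q u + heis_theta q u *\<^sub>R heis_rot q v)) w"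
    by (simp add: metric_chris[OF riemannian_heis_metric[OF assms]] koszul_heis_metric
        linear_add[OF lin] linear_scale[OF lin] rot field_simps)
qed

lemma heis_rot_has_derivative:
  "((\<lambda>q. heis_rot q u) has_derivative
     (\<lambda>w. (- (w $ 2 * u $ 2 + w $ 3 * u $ 3) / 4) *\<^sub>R axis 1 1)) (at p)"
  unfolding heis_rot_def
  by (auto intro!: derivative_eq_intros bounded_linear_imp_has_derivative bounded_linear_vec_nth)

lemma chris_heis_metric_has_derivative:
  assumes "A > 0"
  shows "((\<lambda>q. chris (heis_metric A) q u v) has_derivative
    (\<lambda>w. A *\<^sub>R ((heis_theta p v * (- (w $ 2 * u $ 2 + w $ 3 * u $ 3) / 4)) *\<^sub>R axis 1 1
        - (heis_form w v / 2) *\<^sub>R heis_rot p u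
        + (heis_theta p u * (- (w $ 2 * v $ 2 + w $ 3 * v $ 3) / 4)) *\<^sub>R axis 1 1
        - (heis_form w u / 2) *\<^sub>R heis_rot p v))) (at p)"
  unfolding chris_heis_metric[OF assms]
  by (rule has_derivative_eq_rhs, (rule has_derivative_scaleR_right has_derivative_add
        has_derivative_scaleR heis_theta_has_derivative heis_rot_has_derivative)+)
    (simp add: fun_eq_iff)

lemma chris_differentiable_heis_metric: "A > 0 \<Longrightarrow> chris_differentiable (heis_metric A)"
  unfolding chris_differentiable_def differentiable_def
  using chris_heis_metric_has_derivative by blast

text \<open>At the origin \<open>heis_theta\<close> is the first coordinate and
  \<open>heis_rot\<close> is half a quarter turn of the last two. The formula encodes sectional
  curvature -3A/4 on the horizontal plane and A/4 on every plane containing the first axis.\<close>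

lemma curv_heis_metric_0:
  assumes "A > 0"
  shows "curv (heis_metric A) 0 u v w = vector
    [A / 4 * (w$2 * (u$1 * v$2 - u$2 * v$1) + w$3 * (u$1 * v$3 - u$3 * v$1)),
     - (A^2 / 4) * w$1 * (u$1 * v$2 - u$2 * v$1) - 3 * A / 4 * heis_form u v * w$3,
     - (A^2 / 4) * w$1 * (u$1 * v$3 - u$3 * v$1) + 3 * A / 4 * heis_form u v * w$2]"
  unfolding curv_def frechet_derivative_at[OF chris_heis_metric_has_derivative[OF assms], symmetric]
  by (simp add: chris_heis_metric[OF assms] vec_eq_iff forall_3 vector_3 heis_theta_def heis_form_def
      heis_rot_def field_simps power2_eq_square)

lemma Rc_heis_metric_0:
  assumes "A > 0"
  shows "Rc (heis_metric A) 0 u v = A\<^sup>2 / 2 * u $ 1 * v $ 1 - A / 2 * (u $ 2 * v $ 2 + u $ 3 * v $ 3)"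
  by (simp add: Rc_eq_curv[OF chris_differentiable_heis_metric[OF assms]] curv_heis_metric_0[OF assms]
      sum_3 vector_3 heis_form_def field_simps)

lemma upper_heis_metric_0:
  assumes "A > 0"
  shows "upper (heis_metric A) 0 $ i $ j = (if i = j then if i = 1 then 1 / A else 1 else 0)"
proof -
  have "lower (heis_metric A) 0 ** (\<chi> i j. if i = j then if i = 1 then 1 / A else 1 else 0) = mat 1"
    using assms
    by (simp add: vec_eq_iff forall_3 matrix_matrix_mult_def sum_3 lower_def heis_metric_def
        heis_theta_def heis_form_def mat_def)
  from matrix_inv_eqI[OF this] show ?thesis
    by (simp add: upper_def)
qed

lemma contraction_upper_heis_metric_0:
  assumes "A > 0"
  shows "contraction (upper (heis_metric A) 0) F =
    F (axis 1 1) (axis 1 1) / A + F (axis 2 1) (axis 2 1) + F (axis 3 1) (axis 3 1)"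
  by (simp add: contraction_def sum_3 upper_heis_metric_0[OF assms])

text \<open>In an orthonormal frame each coordinate plane through a direction contributes twice its
  squared sectional curvature: 4(A/4)^2 = A^2/4 for the first axis, whose squared length is A, and
  2(A/4)^2 + 2(3A/4)^2 = 5A^2/4 for the others.\<close>

lemma Rm_squared_heis_metric_0:
  assumes "A > 0"
  shows "Rm_squared (heis_metric A) 0 u v =
    A^3 / 4 * u $ 1 * v $ 1 + 5 * A\<^sup>2 / 4 * (u $ 2 * v $ 2 + u $ 3 * v $ 3)"
proof -
  have m: "heis_metric A 0 x y = A * x $ 1 * y $ 1 + x $ 2 * y $ 2 + x $ 3 * y $ 3" for x y
    by (simp add: heis_metric_def heis_theta_def heis_form_def)
  show ?thesis
    using assms
    by (simp add: Rm_squared_eq_contraction[OF riemannian_heis_metric chris_differentiable_heis_metric]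
        contraction_upper_heis_metric_0 curv_heis_metric_0 m vector_3 heis_form_def)
      (simp add: field_simps power2_eq_square power3_eq_cube power4_eq_xxxx)
qed

section \<open>The Heisenberg group\<close>

text \<open>The differential of left translation by \<open>p\<close>, the same at every base point.
  As a function of \<open>p\<close> it is the left invariant field with value \<open>v\<close> at
  the origin.\<close>

definition heis_translate :: "real^3 \<Rightarrow> real^3 \<Rightarrow> real^3" where
  "heis_translate p v = v + (heis_form p v / 2) *\<^sub>R axis 1 1"

lemma heis_mult_eq: "a \<bullet>\<^sub>H p = a + heis_translate a p"
  by (simp add: heis_mult_def heis_translate_def heis_form_def vec_eq_iff forall_3 vector_3)

lemma heis_translate_linear: "linear (heis_translate p)"
  by (auto intro!: linearI simp: heis_translate_def heis_form_def algebra_simps add_divide_distrib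
      scaleR_add_left scaleR_diff_left diff_divide_distrib)

lemma heis_translate_nth [simp]:
  "heis_translate p v $ 1 = v $ 1 + heis_form p v / 2"
  "heis_translate p v $ 2 = v $ 2" "heis_translate p v $ 3 = v $ 3"
  by (simp_all add: heis_translate_def)

lemma heis_translate_zero [simp]: "heis_translate 0 v = v"
  by (simp add: heis_translate_def heis_form_def)

lemma heis_form_minus [simp]: "heis_form (- x) y = - heis_form x y"
  by (simp add: heis_form_def)

lemma heis_translate_minus [simp]:
  "heis_translate p (heis_translate (- p) v) = v" "heis_translate (- p) (heis_translate p v) = v"
  by (simp_all add: vec_eq_iff forall_3) (simp_all add: heis_form_def)

lemma frechet_derivative_heis_mult: "frechet_derivative ((\<bullet>\<^sub>H) a) (at p) = heis_translate a"
proof -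
  have "((\<lambda>p. a + heis_translate a p) has_derivative heis_translate a) (at p)"
    using has_derivative_add[OF has_derivative_const linear_imp_has_derivative[OF heis_translate_linear]]
    by simp
  then show ?thesis
    by (simp add: frechet_derivative_at[symmetric] heis_mult_eq[abs_def])
qed

lemma heis_theta_translate [simp]: "heis_theta q (heis_translate q x) = x $ 1"
  by (simp add: heis_theta_def heis_form_def)

lemma heis_theta_left_invariant:
  "heis_theta (a \<bullet>\<^sub>H p) (heis_translate a u) = heis_theta p u"
  by (simp add: heis_theta_def heis_mult_eq heis_form_def field_simps)

lemma heis_metric_left_invariant:
  "heis_metric A (a \<bullet>\<^sub>H p) (heis_translate a u) (heis_translate a v) = heis_metric A p u v"
  by (simp add: heis_metric_def heis_theta_left_invariant)

text \<open>Left translation by \<open>-q\<close> is an affine isometry carrying \<open>q\<close> to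
  the origin. There the coefficients are -A^2 - A^2/3 = -(4A/3)A and A - 5A/3 = -2A/3.\<close>

lemma RG_heis_metric:
  assumes "A > 0"
  shows "RG (8 / (3 * A)) (heis_metric A) q u v = - (4 * A / 3) * (A * heis_theta q u * heis_theta q v)
    - (2 * A / 3) * (u $ 2 * v $ 2 + u $ 3 * v $ 3)"
proof -
  have eq: "heis_metric A = (\<lambda>p u v. heis_metric A (- q + heis_translate (- q) p)
      (heis_translate (- q) u) (heis_translate (- q) v))"
    by (simp add: heis_mult_eq[symmetric] heis_metric_left_invariant fun_eq_iff)
  have "- q + heis_translate (- q) q = 0"
    using heis_mult_minus(1)[of q] by (simp add: heis_mult_eq)
  with RG_affine_pullback[OF riemannian_heis_metric[OF assms] heis_translate_linear
      heis_translate_linear _ _ eq chris_differentiable_heis_metric[OF assms], of q "8 / (3 * A)" q u v]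
  have "RG (8 / (3 * A)) (heis_metric A) q u v
      = RG (8 / (3 * A)) (heis_metric A) 0 (heis_translate (- q) u) (heis_translate (- q) v)"
    by simp
  moreover have "heis_translate (- q) u $ 1 = heis_theta q u" for u
    by (simp add: heis_theta_def)
  ultimately show ?thesis
    using assms by (simp add: RG_def Rc_heis_metric_0 Rm_squared_heis_metric_0 del: heis_translate_nth(1))
      (simp add: field_simps power2_eq_square power3_eq_cube)
qed

lemma heis_algebra_iff: "X \<in> heis_algebra \<longleftrightarrow> (\<forall>p. X p = heis_translate p (X 0))"
proof
  assume "X \<in> heis_algebra"
  then have "X (p \<bullet>\<^sub>H 0) = heis_translate p (X 0)" for p
    unfolding heis_algebra_def left_invariant_field_def frechet_derivative_heis_mult by blast
  then show "\<forall>p. X p = heis_translate p (X 0)"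
    unfolding heis_mult_zero by blast
next
  assume X: "\<forall>p. X p = heis_translate p (X 0)"
  \<comment> \<open>The differential of a composite of left translations is the composite of their
    differentials.\<close>
  have "heis_translate (a \<bullet>\<^sub>H p) v = heis_translate a (heis_translate p v)" for a p v
    by (simp add: vec_eq_iff forall_3 heis_mult_eq heis_form_def field_simps)
  then have "X (a \<bullet>\<^sub>H p) = heis_translate a (X p)" for a p
    using X by metis
  then show "X \<in> heis_algebra"
    by (simp add: heis_algebra_def left_invariant_field_def frechet_derivative_heis_mult)
qed

lemma heis_translate_in_heis_algebra: "(\<lambda>p. heis_translate p v) \<in> heis_algebra"
  by (simp add: heis_algebra_iff)

text \<open>Left invariant fields vary only in the central direction, which \<open>heis_form\<close>
  ignores. Each of the two derivative terms therefore contributes half of the constant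
  \<open>heis_form (X 0) (Y 0)\<close>.\<close>

lemma lie_bracket_heis:
  assumes "X \<in> heis_algebra" "Y \<in> heis_algebra"
  shows "lie_bracket X Y = (\<lambda>p. heis_form (X 0) (Y 0) *\<^sub>R axis 1 1)"
proof -
  have d: "((\<lambda>p. heis_translate p v) has_derivative (\<lambda>w. (heis_form w v / 2) *\<^sub>R axis 1 1)) (at p)" for v p
  proof -
    have "((\<lambda>p. v + heis_form p v *\<^sub>R (axis 1 1 /\<^sub>R 2)) has_derivative
        (\<lambda>w. heis_form w v *\<^sub>R (axis 1 1 /\<^sub>R 2))) (at p)"
      using linear_imp_has_derivative[OF heis_form_linear(2), of v "at p"]
      by (auto intro!: derivative_eq_intros)
    then show ?thesis by (simp add: heis_translate_def)
  qed
  obtain x y where X: "X = (\<lambda>p. heis_translate p x)" and Y: "Y = (\<lambda>p. heis_translate p y)"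
    using assms unfolding heis_algebra_iff by blast
  show ?thesis
    unfolding lie_bracket_def X Y frechet_derivative_at[OF d, symmetric]
    by (simp add: fun_eq_iff vec_eq_iff forall_3 heis_form_def field_simps)
qed

section \<open>Dilations and the soliton derivation\<close>

definition heis_dilation :: "real \<Rightarrow> real^3 \<Rightarrow> real^3" where
  "heis_dilation s x = (s * s * x $ 1) *\<^sub>R axis 1 1 + (s * x $ 2) *\<^sub>R axis 2 1 + (s * x $ 3) *\<^sub>R axis 3 1"

lemma heis_dilation_linear: "linear (heis_dilation s)"
  by (auto intro!: linearI simp: heis_dilation_def algebra_simps)

lemma heis_dilation_one: "heis_dilation 1 x = x"
  by (simp add: heis_dilation_def vec_eq_iff forall_3)

lemma heis_dilation_inverse:
  "s \<noteq> 0 \<Longrightarrow> heis_dilation s (heis_dilation (inverse s) x) = x"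
  "s \<noteq> 0 \<Longrightarrow> heis_dilation (inverse s) (heis_dilation s x) = x"
  by (simp_all add: heis_dilation_def vec_eq_iff forall_3 field_simps)

lemma heis_theta_dilation:
  "heis_theta (heis_dilation s q) (heis_dilation s u) = s * s * heis_theta q u"
  by (simp add: heis_theta_def heis_form_def heis_dilation_def field_simps)

text \<open>The operator of RG at the identity. It is twice the generator of the dilations with s =
  exp(-At/3), since pulling back a metric acts on both of its arguments.\<close>

definition heis_soliton_op :: "real \<Rightarrow> real^3 \<Rightarrow> real^3" where
  "heis_soliton_op A x = (- (4 * A / 3) * x $ 1) *\<^sub>R axis 1 1
     + (- (2 * A / 3) * x $ 2) *\<^sub>R axis 2 1 + (- (2 * A / 3) * x $ 3) *\<^sub>R axis 3 1"

lemma heis_soliton_op_linear: "linear (heis_soliton_op A)"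
  by (auto intro!: linearI simp: heis_soliton_op_def vec_eq_iff forall_3 field_simps)

lemma heis_soliton_op_derivation:
  "heis_form (heis_soliton_op A x) y *\<^sub>R axis 1 1 + heis_form x (heis_soliton_op A y) *\<^sub>R axis 1 1
    = heis_soliton_op A (heis_form x y *\<^sub>R axis 1 1)"
  by (simp add: heis_form_def heis_soliton_op_def vec_eq_iff forall_3 field_simps)

lemma heis_metric_soliton_op:
  assumes "A > 0"
  shows "heis_metric A q (heis_translate q (heis_soliton_op A x)) v
    = RG (8 / (3 * A)) (heis_metric A) q (heis_translate q x) v"
  by (simp add: RG_heis_metric[OF assms] heis_metric_def del: heis_translate_nth(1))
    (simp add: heis_soliton_op_def field_simps)

text \<open>\<open>V\<close> sends the standard basis to the frame at the origin. It is bijective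
  because the frame spans, and it respects brackets because both bases satisfy the same bracket
  relation.\<close>

lemma left_invariant_frame_automorphism:
  assumes frame: "left_invariant_frame e" and br: "lie_bracket (e 2) (e 3) = e 1"
  obtains V Q where "linear V" "linear Q" "\<And>x. V (Q x) = x" "\<And>x. Q (V x) = x"
    "\<And>x y. heis_form (V x) (V y) *\<^sub>R axis 1 1 = V (heis_form x y *\<^sub>R axis 1 1)"
    "\<And>i p. e i p = heis_translate p (V (axis i 1))"
proof -
  define V where "V x = (\<Sum>i\<in>UNIV. x $ i *\<^sub>R e i 0)" for x :: "real^3"
  have V: "linear V"
    by (auto intro!: linearI simp: V_def algebra_simps sum.distrib scaleR_sum_right)
  have Va: "V (axis i 1) = e i 0" for i
    by (simp add: V_def)
  have he: "e i \<in> heis_algebra" for i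
    using frame by (simp add: left_invariant_frame_def)
  have "UNIV = span (range (\<lambda>i. e i 0))"
    using frame by (simp add: left_invariant_frame_def)
  also have "\<dots> \<subseteq> range V"
    using Va by (intro span_minimal linear_subspace_image V subspace_UNIV) (metis image_subsetI rangeI)
  finally have "surj V" by auto
  from linear_surjective_isomorphism[OF V this]
  obtain Q where Q: "linear Q" "\<And>x. Q (V x) = x" "\<And>x. V (Q x) = x" by blast
  \<comment> \<open>As a bracket, the first frame vector lies on the central axis, so
    \<open>V\<close> preserves the centre and acts on the horizontal coordinates by a 2 by 2
    block.\<close>
  have e1: "e 1 0 = heis_form (e 2 0) (e 3 0) *\<^sub>R axis 1 1"
    using lie_bracket_heis[OF he he, of 2 3] br by simp
  then have e1_nth: "e 1 0 $ 2 = 0" "e 1 0 $ 3 = 0" by simp_all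
  have "V x $ 2 = x $ 2 * e 2 0 $ 2 + x $ 3 * e 3 0 $ 2" "V x $ 3 = x $ 2 * e 2 0 $ 3 + x $ 3 * e 3 0 $ 3" for x
    by (simp_all add: V_def sum_3 e1_nth)
  \<comment> \<open>The factor \<open>heis_form (e 2 0) (e 3 0)\<close> is the determinant of that
    block, the same number by which \<open>V\<close> scales the central axis.\<close>
  then have "heis_form (V x) (V y) = (x $ 2 * y $ 3 - x $ 3 * y $ 2) * heis_form (e 2 0) (e 3 0)" for x y
    by (simp add: heis_form_def algebra_simps)
  then have "heis_form (V x) (V y) *\<^sub>R axis 1 1 = V (heis_form x y *\<^sub>R axis 1 1)" for x y
    using Va[of 1] by (simp add: linear_scale[OF V] heis_form_def[of x y] e1)
  moreover have "e i p = heis_translate p (V (axis i 1))" for i p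
    using he[of i] unfolding heis_algebra_iff Va by blast
  ultimately show ?thesis
    using that V Q by blast
qed

section \<open>Transport along a linear automorphism\<close>

context
  fixes V Q :: "real^3 \<Rightarrow> real^3"
  assumes V: "linear V" and Q: "linear Q"
    and VQ: "\<And>x. V (Q x) = x" and QV: "\<And>x. Q (V x) = x"
    and aut: "\<And>x y. heis_form (V x) (V y) *\<^sub>R axis 1 1 = V (heis_form x y *\<^sub>R axis 1 1)"
begin

lemma heis_form_inverse_automorphism:
  "heis_form (Q x) (Q y) *\<^sub>R axis 1 1 = Q (heis_form x y *\<^sub>R axis 1 1)"
  using aut[of "Q x" "Q y"] by (metis VQ QV)

lemma heis_translate_automorphism: "Q (heis_translate p v) = heis_translate (Q p) (Q v)"
proof -
  have "Q ((1 / 2) *\<^sub>R heis_form p v *\<^sub>R axis 1 1) = (1 / 2) *\<^sub>R heis_form (Q p) (Q v) *\<^sub>R axis 1 1"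
    unfolding linear_scale[OF Q, of "1 / 2"] by (simp only: heis_form_inverse_automorphism)
  then show ?thesis
    by (simp add: heis_translate_def linear_add[OF Q])
qed

lemma heis_mult_automorphism: "Q (a \<bullet>\<^sub>H p) = Q a \<bullet>\<^sub>H Q p"
  by (simp add: heis_mult_eq linear_add[OF Q] heis_translate_automorphism)

text \<open>The dual coframe reads off the coefficients of \<open>u\<close> in the frame at
  \<open>p\<close>. These are found by translating \<open>u\<close> back to the origin and applying
  \<open>Q\<close>, which commutes with translation up to moving the base point.\<close>

lemma dual_coframe_automorphism:
  assumes e: "\<And>i p. e i p = heis_translate p (V (axis i 1))" and dual: "dual_coframe e \<omega>"
  shows "\<omega> i p u = heis_translate (- Q p) (Q u) $ i"
proof -
  define x where "x = Q (heis_translate (- p) u)"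
  have lin: "linear (\<lambda>x. heis_translate p (V x))" "linear (\<omega> i p)"
    using linear_compose[OF V heis_translate_linear] dual by (simp_all add: o_def dual_coframe_def)
  have "u = heis_translate p (V x)"
    by (simp add: x_def VQ)
  also have "\<dots> = (\<Sum>j\<in>UNIV. x $ j *\<^sub>R e j p)"
    unfolding e by (rule linear_axis_expansion[OF lin(1)])
  finally have "\<omega> i p u = (\<Sum>j\<in>UNIV. x $ j * (if i = j then 1 else 0))"
    using dual by (simp add: linear_sum[OF lin(2)] linear_scale[OF lin(2)] dual_coframe_def)
  also have "\<dots> = x $ i"
    by (simp add: if_distrib cong: if_cong)
  finally show ?thesis
    by (simp add: x_def heis_translate_automorphism linear_neg[OF Q])
qed

section \<open>The soliton property and the flow of the transported metric\<close>

context
  fixes A :: real and g0 :: "3 tensor2"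
  assumes A: "A > 0" and g0: "g0 = (\<lambda>p u v. heis_metric A (Q p) (Q u) (Q v))"
begin

lemma g0_affine: "g0 = (\<lambda>p u v. heis_metric A (0 + Q p) (Q u) (Q v))"
  by (simp add: g0)

lemma riemannian_g0: "riemannian_metric g0"
  by (rule riemannian_affine_pullback[OF riemannian_heis_metric[OF A] Q V QV VQ g0_affine])

lemma RG_g0: "RG \<alpha> g0 p u v = RG \<alpha> (heis_metric A) (Q p) (Q u) (Q v)"
  unfolding RG_affine_pullback[OF riemannian_heis_metric[OF A] Q V QV VQ g0_affine
      chris_differentiable_heis_metric[OF A]] by simp

lemma left_invariant_g0: "left_invariant_metric g0"
  unfolding left_invariant_metric_def pullback_def frechet_derivative_heis_mult
  by (simp add: riemannian_g0)
    (simp add: g0 heis_mult_automorphism heis_translate_automorphism heis_metric_left_invariant)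

text \<open>The operator for \<open>heis_metric\<close> is conjugated by the automorphism.
  Uniqueness follows from nondegeneracy.\<close>

lemma hat_g0:
  assumes X: "X \<in> heis_algebra"
  shows "hat g0 (RG (8 / (3 * A)) g0) X = (\<lambda>p. heis_translate p (V (heis_soliton_op A (Q (X 0)))))"
  unfolding hat_def
proof (rule the_equality)
  let ?Z = "\<lambda>p. heis_translate p (V (heis_soliton_op A (Q (X 0))))"
  have eq: "g0 p (?Z p) y = RG (8 / (3 * A)) g0 p (X p) y" for p y
  proof -
    have "X p = heis_translate p (X 0)"
      using X unfolding heis_algebra_iff by blast
    then show ?thesis
      unfolding RG_g0 by (simp add: g0 heis_translate_automorphism QV heis_metric_soliton_op[OF A])
  qed
  then show "?Z \<in> heis_algebra \<and>
      (\<forall>Y\<in>heis_algebra. \<forall>p. g0 p (?Z p) (Y p) = RG (8 / (3 * A)) g0 p (X p) (Y p))"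
    by (simp add: heis_translate_in_heis_algebra)
  fix Z
  assume Z: "Z \<in> heis_algebra \<and>
      (\<forall>Y\<in>heis_algebra. \<forall>p. g0 p (Z p) (Y p) = RG (8 / (3 * A)) g0 p (X p) (Y p))"
  show "Z = ?Z"
  proof
    fix p
    have "g0 p (Z p) w = g0 p (?Z p) w" for w
    proof -
      \<comment> \<open>Every tangent vector \<open>w\<close> at \<open>p\<close> is the value of a
        left invariant field, so testing against such fields suffices.\<close>
      have "g0 p (Z p) (heis_translate p (heis_translate (- p) w))
          = RG (8 / (3 * A)) g0 p (X p) (heis_translate p (heis_translate (- p) w))"
        using bspec[OF conjunct2[OF Z] heis_translate_in_heis_algebra] by blast
      then show ?thesis by (simp add: eq)
    qed
    then show "Z p = ?Z p"
      by (rule metric_nondegenerate[OF riemannian_g0])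
  qed
qed

lemma steady_algebraic_soliton_g0: "steady_algebraic_soliton (8 / (3 * A)) g0"
proof -
  let ?S = "\<lambda>v. V (heis_soliton_op A (Q v))"
  have "linear ?S"
    using linear_compose[OF linear_compose[OF Q heis_soliton_op_linear] V] by (simp add: o_def)
  note S = linear_add[OF this] linear_scale[OF this]
  note T = linear_add[OF heis_translate_linear] linear_scale[OF heis_translate_linear]
  have closed: "(\<lambda>p. X p + Y p) \<in> heis_algebra" "(\<lambda>p. r *\<^sub>R X p) \<in> heis_algebra"
    if "X \<in> heis_algebra" "Y \<in> heis_algebra" for X Y r
    using that by (metis (no_types, lifting) T heis_algebra_iff)+
  have central: "heis_translate p (c *\<^sub>R axis 1 1) = c *\<^sub>R axis 1 1" for p c
    by (simp add: vec_eq_iff forall_3 heis_form_def)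
  \<comment> \<open>Conjugating a derivation by an automorphism gives a derivation.\<close>
  have S_bracket: "?S (heis_form x y *\<^sub>R axis 1 1) = heis_form (?S x) y *\<^sub>R axis 1 1
      + heis_form x (?S y) *\<^sub>R axis 1 1" for x y
  proof -
    have "?S (heis_form x y *\<^sub>R axis 1 1) = V (heis_form (heis_soliton_op A (Q x)) (Q y) *\<^sub>R axis 1 1
        + heis_form (Q x) (heis_soliton_op A (Q y)) *\<^sub>R axis 1 1)"
      by (simp only: heis_form_inverse_automorphism[symmetric] heis_soliton_op_derivation)
    then show ?thesis
      by (simp only: linear_add[OF V] aut[symmetric] VQ)
  qed
  have "derivation (\<lambda>X. hat g0 (RG (8 / (3 * A)) g0) X)"
    unfolding derivation_def
  proof (intro conjI ballI allI)
    fix X Y assume X: "X \<in> heis_algebra" and Y: "Y \<in> heis_algebra"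
    have br: "lie_bracket X Y \<in> heis_algebra"
      by (simp add: lie_bracket_heis[OF X Y] heis_algebra_iff central)
    \<comment> \<open>By the Leibniz rule the image of a bracket is again central, hence unchanged
      by translation.\<close>
    have "?S (heis_form (X 0) (Y 0) *\<^sub>R axis 1 1)
      = heis_translate p (?S (heis_form (X 0) (Y 0) *\<^sub>R axis 1 1))" for p
      unfolding S_bracket scaleR_add_left[symmetric] central ..
    then show "hat g0 (RG (8 / (3 * A)) g0) (lie_bracket X Y) = (\<lambda>p.
        lie_bracket (hat g0 (RG (8 / (3 * A)) g0) X) Y p + lie_bracket X (hat g0 (RG (8 / (3 * A)) g0) Y) p)"
      unfolding hat_g0[OF br] hat_g0[OF X] hat_g0[OF Y]
      by (simp only: lie_bracket_heis X Y heis_translate_in_heis_algebra heis_translate_zero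
          S_bracket[symmetric])
  qed (simp_all add: hat_g0 closed heis_translate_in_heis_algebra S T)
  then show ?thesis
    by (simp add: steady_algebraic_soliton_def algebraic_soliton_def left_invariant_g0)
qed

lemma self_similar_g0:
  "\<exists>g. self_similar_solution (\<lambda>h p u v. - 2 * Rc h p u v - 4 / (3 * A) * Rm_squared h p u v) g0 g"
proof -
  \<comment> \<open>The dilation scales the two parts of the metric by s^4 and s^2. With s' =
    -(A/3)s their logarithmic derivatives are -4A/3 and -2A/3, exactly the two eigenvalues of
    RG.\<close>
  define s where "s t = exp (- (A / 3) * t)" for t
  \<comment> \<open>The dilation is conjugated by \<open>V\<close> so that \<open>Q\<close> cancels
    \<open>V\<close> when \<open>g0\<close> is pulled back, leaving \<open>g t\<close>.\<close>
  define \<phi> where "\<phi> t x = V (heis_dilation (s t) (Q x))" for t x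
  define g where "g t = (\<lambda>p u v. heis_metric A (heis_dilation (s t) (Q p))
      (heis_dilation (s t) (Q u)) (heis_dilation (s t) (Q v)))" for t
  have s: "s t \<noteq> 0" for t by (simp add: s_def)
  have dQ: "linear (\<lambda>x. heis_dilation r (Q x))" and Vd: "linear (\<lambda>x. V (heis_dilation r x))" for r
    using linear_compose[OF Q heis_dilation_linear] linear_compose[OF heis_dilation_linear V]
    by (simp_all add: o_def)
  have inv1: "heis_dilation (s t) (Q (V (heis_dilation (inverse (s t)) x))) = x"
    and inv2: "V (heis_dilation (inverse (s t)) (heis_dilation (s t) (Q x))) = x" for t x
    by (simp_all add: QV VQ heis_dilation_inverse s)
  have g: "g t = (\<lambda>p u v. heis_metric A (0 + heis_dilation (s t) (Q p))
      (heis_dilation (s t) (Q u)) (heis_dilation (s t) (Q v)))" for t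
    by (simp add: g_def)
  have riem: "riemannian_metric (g t)" for t
    by (rule riemannian_affine_pullback[OF riemannian_heis_metric[OF A] dQ Vd inv1 inv2 g])
  have "((\<lambda>t. g t p u v) has_real_derivative RG (8 / (3 * A)) (g t) p u v) (at t)" for t p u v
  proof -
    let ?a = "A * heis_theta (Q p) (Q u) * heis_theta (Q p) (Q v)"
    let ?b = "Q u $ 2 * Q v $ 2 + Q u $ 3 * Q v $ 3"
    have "(s has_real_derivative - (A / 3) * s t) (at t)"
      unfolding s_def by (auto intro!: derivative_eq_intros)
    then have "((\<lambda>t. s t ^ 4 * ?a + s t ^ 2 * ?b) has_real_derivative
        - (4 * A / 3) * (s t ^ 4 * ?a) - (2 * A / 3) * (s t ^ 2 * ?b)) (at t)"
      by (auto intro!: derivative_eq_intros simp: power2_eq_square power3_eq_cube power4_eq_xxxx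
          algebra_simps)
    moreover have "(\<lambda>t. g t p u v) = (\<lambda>t. s t ^ 4 * ?a + s t ^ 2 * ?b)"
      by (simp add: g_def heis_metric_def heis_theta_dilation fun_eq_iff)
        (simp add: heis_dilation_def power2_eq_square power4_eq_xxxx algebra_simps)
    \<comment> \<open>Each \<open>g t\<close> is itself a linear pullback of
      \<open>heis_metric\<close>, so its RG tensor is the pullback of the known one and scales by
      the same powers of \<open>s t\<close>.\<close>
    moreover have "RG (8 / (3 * A)) (g t) p u v
        = - (4 * A / 3) * (s t ^ 4 * ?a) - (2 * A / 3) * (s t ^ 2 * ?b)"
      unfolding RG_affine_pullback[OF riemannian_heis_metric[OF A] dQ Vd inv1 inv2 g
          chris_differentiable_heis_metric[OF A]] RG_heis_metric[OF A] add_0 heis_theta_dilation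
      by (simp add: heis_dilation_def power2_eq_square power4_eq_xxxx algebra_simps)
    ultimately show ?thesis by simp
  qed
  moreover have "RG (8 / (3 * A)) h = (\<lambda>p u v. - 2 * Rc h p u v - 4 / (3 * A) * Rm_squared h p u v)"
    for h :: "3 tensor2"
    by (simp add: RG_def fun_eq_iff)
  ultimately have "flow_solution (\<lambda>h p u v. - 2 * Rc h p u v - 4 / (3 * A) * Rm_squared h p u v) g"
    using riem by (simp add: flow_solution_def)
  moreover have "one_parameter_family \<phi>"
    unfolding one_parameter_family_def
  proof (intro conjI allI)
    fix t
    have lin: "linear (\<lambda>x. V (heis_dilation r (Q x)))" for r
      using linear_compose[OF dQ V] by (simp add: o_def)
    let ?\<psi> = "\<lambda>x. V (heis_dilation (inverse (s t)) (Q x))"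
    have \<psi>: "\<phi> t (?\<psi> x) = x" "?\<psi> (\<phi> t x) = x" for x
      by (simp_all add: \<phi>_def QV VQ heis_dilation_inverse s)
    have "bij (\<phi> t)"
      by (rule o_bij[of ?\<psi>]) (simp_all add: fun_eq_iff \<psi>)
    moreover have "inv (\<phi> t) = ?\<psi>"
      by (rule inv_equality) (rule \<psi>)+
    ultimately show "diffeomorphism (\<phi> t)"
      using lin by (simp add: diffeomorphism_def smooth_linear \<phi>_def[abs_def])
  next
    have q: "linear (\<lambda>z::real \<times> (real^3). Q (snd z) $ i *\<^sub>R V (axis i 1))" for i
      by (auto intro!: linearI simp: linear_add[OF Q] linear_scale[OF Q] algebra_simps)
    have s_smooth: "smooth (\<lambda>z::real \<times> (real^3). s (fst z))"
      unfolding s_def by (intro smooth_exp_linear linearI) (auto simp: algebra_simps)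
    \<comment> \<open>For joint smoothness in time and position, the map is written as a sum of
      linear functions of position multiplied by powers of \<open>s\<close>.\<close>
    have "smooth (\<lambda>z. s (fst z) *\<^sub>R s (fst z) *\<^sub>R (Q (snd z) $ 1 *\<^sub>R V (axis 1 1))
        + s (fst z) *\<^sub>R (Q (snd z) $ 2 *\<^sub>R V (axis 2 1))
        + s (fst z) *\<^sub>R (Q (snd z) $ 3 *\<^sub>R V (axis 3 1)))"
      by (intro s_smooth smooth_linear[OF q] smooth_add smooth_scaleR)
    moreover have "(\<lambda>(t, x). \<phi> t x) =
        (\<lambda>z. s (fst z) *\<^sub>R s (fst z) *\<^sub>R (Q (snd z) $ 1 *\<^sub>R V (axis 1 1))
        + s (fst z) *\<^sub>R (Q (snd z) $ 2 *\<^sub>R V (axis 2 1))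
        + s (fst z) *\<^sub>R (Q (snd z) $ 3 *\<^sub>R V (axis 3 1)))"
      by (simp add: fun_eq_iff \<phi>_def heis_dilation_def linear_add[OF V] linear_scale[OF V] mult.assoc)
    ultimately show "smooth (\<lambda>(t, x). \<phi> t x)" by simp
  qed
  moreover have "\<phi> 0 = id"
    by (simp add: \<phi>_def s_def fun_eq_iff heis_dilation_one VQ)
  moreover have "pullback (\<phi> t) g0 = g t" for t
  proof -
    have "linear (\<phi> t)"
      using linear_compose[OF dQ V] by (simp add: o_def \<phi>_def[abs_def])
    then show ?thesis
      by (simp add: pullback_def frechet_derivative_linear) (simp add: g0 g_def \<phi>_def QV)
  qed
  ultimately have "self_similar_solution
      (\<lambda>h p u v. - 2 * Rc h p u v - 4 / (3 * A) * Rm_squared h p u v) g0 g"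
    unfolding self_similar_solution_def
    \<comment> \<open>The soliton is steady, so the scaling factor c is constantly 1.\<close>
    by (intro conjI exI[of _ "\<lambda>t. 1"] exI[of _ \<phi>]) simp_all
  then show ?thesis by (rule exI[of _ g])
qed

end

end

theorem theorem3p3:
  fixes e :: "3 \<Rightarrow> 3 vector_field"
    and \<omega> :: "3 \<Rightarrow> 3 one_form"
    and A :: real
    and g0 :: "3 tensor2"
  assumes "left_invariant_frame e"
    and "lie_bracket (e 2) (e 3) = e 1"
    and "lie_bracket (e 1) (e 2) = (\<lambda>p. 0)"
    and "lie_bracket (e 1) (e 3) = (\<lambda>p. 0)"
    and "dual_coframe e \<omega>"
    and "A > 0"
    and "g0 = (\<lambda>p u v. A * (\<omega> 1 \<otimes>\<^sub>f \<omega> 1) p u v + (\<omega> 2 \<otimes>\<^sub>f \<omega> 2) p u v + (\<omega> 3 \<otimes>\<^sub>f \<omega> 3) p u v)"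
  shows "steady_algebraic_soliton (8 / (3 * A)) g0 \<and>
    (\<exists>g. self_similar_solution
           (\<lambda>h p u v. - 2 * Rc h p u v - 4 / (3 * A) * Rm_squared h p u v) g0 g)"
proof -
  obtain V Q where V: "linear V" "linear Q" "\<And>x. V (Q x) = x" "\<And>x. Q (V x) = x"
    "\<And>x y. heis_form (V x) (V y) *\<^sub>R axis 1 1 = V (heis_form x y *\<^sub>R axis 1 1)"
    and e: "\<And>i p. e i p = heis_translate p (V (axis i 1))"
    using left_invariant_frame_automorphism[OF assms(1,2)] by metis
  note \<omega> = dual_coframe_automorphism[OF V e assms(5)]
  have "g0 = (\<lambda>p u v. heis_metric A (Q p) (Q u) (Q v))"
    unfolding assms(7) by (simp add: tensor_prod_def \<omega> heis_metric_def heis_theta_def mult.assoc)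
  with steady_algebraic_soliton_g0[OF V assms(6)] self_similar_g0[OF V assms(6)]
  show ?thesis by blast
qed

end
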